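(* (Kripke completeness of $\mathsf{NQGL}^-$.) For every formula $\phi$, $\phi$ is derivable in $\mathsf{NQGL}^-$ (i.e. $\vdash_{\mathsf{NQGL}^-}\,\rightarrow\phi$) if and only if $\mathfrak{BL}\models\phi$.
   Context: Formulas are those of first-order modal logic over a countable set $\mathcal{V}$ of variables, with $\top,\bot$, predicate symbols of each finite arity (no function/constant symbols), $\land,\neg,\supset$, $\forall$, and $\Box$; $\Diamond=\neg\Box\neg$ and $\Diamond^n$ is $n$-fold $\Diamond$. $\mathsf{NQGL}^-$ is the following sequent calculus (sequents $\Gamma\rightarrow\Delta$ are pairs of finite sets of formulas). Axioms: $p\rightarrow p$ ($p$ atomic), $\rightarrow\top$, $\bot\rightarrow$. Rules: weakening (from $\Gamma\rightarrow\Delta$ infer $\Gamma'\rightarrow\Delta'$ for $\Gamma\subseteq\Gamma'$, $\Delta\subseteq\Delta'$); standard LK rules for $\land$ (right: from $\Gamma\rightarrow\Delta,\phi$ and $\Gamma\rightarrow\Delta,\psi$ infer $\Gamma\rightarrow\Delta,\phi\land\psi$; left: from $\phi,\Gamma\rightarrow\Delta$ or $\psi,\Gamma\rightarrow\Delta$ infer $\phi\land\psi,\Gamma\rightarrow\Delta$), for $\supset$ (right: from $\phi,\Gamma\rightarrow\Delta,\psi$ infer $\Gamma\rightarrow\Delta,\phi\supset\psi$; left: from $\Gamma\rightarrow\Delta,\phi$ and $\psi,\Lambda\rightarrow\Xi$ infer $\phi\supset\psi,\Gamma,\Lambda\rightarrow\Delta,\Xi$), for $\neg$ (from $\phi,\Gamma\rightarrow\Delta$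 infer $\Gamma\rightarrow\Delta,\neg\phi$; from $\Gamma\rightarrow\Delta,\phi$ infer $\neg\phi,\Gamma\rightarrow\Delta$), for $\forall$ (from $\Gamma\rightarrow\Delta,\phi[y/x]$ infer $\Gamma\rightarrow\Delta,\forall x\phi$ with $y$ not occurring in the lower sequent; from $\phi[z/x],\Gamma\rightarrow\Delta$ infer $\forall x\phi,\Gamma\rightarrow\Delta$ for any $z$); (Box) from $\Box\Gamma,\Delta\rightarrow\phi$ infer $\Box\Gamma,\Box\Delta\rightarrow\Box\phi$ (where $\Box\Gamma=\{\Box\gamma\mid\gamma\in\Gamma\}$); and (Boundedness of length) from $\Gamma\rightarrow\Delta,\Diamond^n\top$ for all $n\in\mathbb{N}$ infer $\Gamma\rightarrow\Delta$. There is no cut rule. Derivations may be infinitary (well-founded trees). Semantics: a Kripke frame is $(W,R)$ with $W\neq\emptyset$, $R\subseteq W\times W$; a Kripke model over it is $(W,R,D,I)$ where $(D_w)_{w\in W}$ are non-empty domains with $D_{w_1}\subseteq D_{w_2}$ whenever $(w_1,w_2)\in R$, and $I(w,P)\subseteq (D_w)^n$ for $n$-ary $P$. Truth at a world is classical, with $\forall x$ ranging over $D_w$ and $\Box\phi$ true at $w$ iff $\phi$ is true at every $R$-successor of $w$. A non-closed formula is valid iff its universal closure is; $F\models\phi$ means $\phi$ is true at every world of every model over $F$; $\mathfrak{BL}\models\phi$ means $F\models\phi$ for every $F\in\mathfrak{BL}$, where $\mathfrak{BL}$ is the class of transitive Kripke frames $(W,R)$ of bounded length, i.e. for every $w\in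 W$ the supremum of the lengths $n$ of $R$-paths $w=w_0Rw_1R\cdots Rw_n$ is finite. *)

theory Defs
  imports Main "HOL-Library.FSet"
begin

type_synonym var = nat

text \<open>The predicate symbols of arity \<open>n\<close> are the pairs of an element \<open>P\<close> of the (arbitrary) type
  \<open>'p\<close> with the number \<open>n\<close>; the arity is given by the length of the argument list, so \<open>Pred P xs\<close>
  and \<open>Pred P ys\<close> with \<open>length xs \<noteq> length ys\<close> carry different symbols.\<close>

datatype 'p fm =
    Top
  | Bot
  | Pred 'p "var list"
  | And "'p fm" "'p fm"
  | Neg "'p fm"
  | Imp "'p fm" "'p fm"
  | Forall var "'p fm"
  | Box "'p fm"

definition Dia :: "'p fm \<Rightarrow> 'p fm" where
  "Dia \<phi> = Neg (Box (Neg \<phi>))"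

primrec fv :: "'p fm \<Rightarrow> var set" where
  "fv Top = {}"
| "fv Bot = {}"
| "fv (Pred P xs) = set xs"
| "fv (And \<phi> \<psi>) = fv \<phi> \<union> fv \<psi>"
| "fv (Neg \<phi>) = fv \<phi>"
| "fv (Imp \<phi> \<psi>) = fv \<phi> \<union> fv \<psi>"
| "fv (Forall x \<phi>) = fv \<phi> - {x}"
| "fv (Box \<phi>) = fv \<phi>"

text \<open>All variables occurring in a formula, whether free, bound, or only next to a quantifier.\<close>

primrec vars :: "'p fm \<Rightarrow> var set" where
  "vars Top = {}"
| "vars Bot = {}"
| "vars (Pred P xs) = set xs"
| "vars (And \<phi> \<psi>) = vars \<phi> \<union> vars \<psi>"
| "vars (Neg \<phi>) = vars \<phi>"
| "vars (Imp \<phi> \<psi>) = vars \<phi> \<union> vars \<psi>"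
| "vars (Forall x \<phi>) = insert x (vars \<phi>)"
| "vars (Box \<phi>) = vars \<phi>"

text \<open>Capture-avoiding simultaneous substitution of variables for variables: a quantified variable
  is kept unless it would capture one of the substituted variables, in which case it is replaced
  by the least variable that captures none.\<close>

primrec msubst :: "(var \<Rightarrow> var) \<Rightarrow> 'p fm \<Rightarrow> 'p fm" where
  "msubst \<sigma> Top = Top"
| "msubst \<sigma> Bot = Bot"
| "msubst \<sigma> (Pred P xs) = Pred P (map \<sigma> xs)"
| "msubst \<sigma> (And \<phi> \<psi>) = And (msubst \<sigma> \<phi>) (msubst \<sigma> \<psi>)"
| "msubst \<sigma> (Neg \<phi>) = Neg (msubst \<sigma> \<phi>)"
| "msubst \<sigma> (Imp \<phi> \<psi>) = Imp (msubst \<sigma> \<phi>) (msubst \<sigma> \<psi>)"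
| "msubst \<sigma> (Forall x \<phi>) =
    (let C = \<sigma> ` (fv \<phi> - {x});
         u = (if x \<in> C then LEAST u. u \<notin> C else x)
     in Forall u (msubst (\<sigma>(x := u)) \<phi>))"
| "msubst \<sigma> (Box \<phi>) = Box (msubst \<sigma> \<phi>)"

definition subst :: "'p fm \<Rightarrow> var \<Rightarrow> var \<Rightarrow> 'p fm"  (\<open>_[_'/_]\<close> [1000, 0, 0] 1000) where
  "\<phi>[y/x] = msubst (id(x := y)) \<phi>"

text \<open>The calculus NQGL\<open>\<^sup>-\<close>: \<open>\<Gamma> \<turnstile> \<Delta>\<close> states that the sequent with antecedent \<open>\<Gamma>\<close> and succedent \<open>\<Delta>\<close>
  is derivable. The premise of \<open>BoundL\<close> ranges over all \<open>n\<close>, so the inductive definition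
  amounts to well-founded infinitely branching derivations.\<close>

inductive derivable :: "'p fm fset \<Rightarrow> 'p fm fset \<Rightarrow> bool"  (infix \<open>\<turnstile>\<close> 50) where
  Ax: "{|Pred P xs|} \<turnstile> {|Pred P xs|}"
| TopR: "{||} \<turnstile> {|Top|}"
| BotL: "{|Bot|} \<turnstile> {||}"
| Weak: "\<Gamma> \<turnstile> \<Delta> \<Longrightarrow> \<Gamma> |\<subseteq>| \<Gamma>' \<Longrightarrow> \<Delta> |\<subseteq>| \<Delta>' \<Longrightarrow> \<Gamma>' \<turnstile> \<Delta>'"
| AndR: "\<Gamma> \<turnstile> finsert \<phi> \<Delta> \<Longrightarrow> \<Gamma> \<turnstile> finsert \<psi> \<Delta> \<Longrightarrow> \<Gamma> \<turnstile> finsert (And \<phi> \<psi>) \<Delta>"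
| AndL1: "finsert \<phi> \<Gamma> \<turnstile> \<Delta> \<Longrightarrow> finsert (And \<phi> \<psi>) \<Gamma> \<turnstile> \<Delta>"
| AndL2: "finsert \<psi> \<Gamma> \<turnstile> \<Delta> \<Longrightarrow> finsert (And \<phi> \<psi>) \<Gamma> \<turnstile> \<Delta>"
| ImpR: "finsert \<phi> \<Gamma> \<turnstile> finsert \<psi> \<Delta> \<Longrightarrow> \<Gamma> \<turnstile> finsert (Imp \<phi> \<psi>) \<Delta>"
| ImpL: "\<Gamma> \<turnstile> finsert \<phi> \<Delta> \<Longrightarrow> finsert \<psi> \<Lambda> \<turnstile> \<Xi> \<Longrightarrow> finsert (Imp \<phi> \<psi>) (\<Gamma> |\<union>| \<Lambda>) \<turnstile> \<Delta> |\<union>| \<Xi>"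
| NegR: "finsert \<phi> \<Gamma> \<turnstile> \<Delta> \<Longrightarrow> \<Gamma> \<turnstile> finsert (Neg \<phi>) \<Delta>"
| NegL: "\<Gamma> \<turnstile> finsert \<phi> \<Delta> \<Longrightarrow> finsert (Neg \<phi>) \<Gamma> \<turnstile> \<Delta>"
| ForallR: "\<Gamma> \<turnstile> finsert (\<phi>[y/x]) \<Delta>
    \<Longrightarrow> (\<forall>\<psi>. \<psi> |\<in>| \<Gamma> |\<union>| finsert (Forall x \<phi>) \<Delta> \<longrightarrow> y \<notin> vars \<psi>)
    \<Longrightarrow> \<Gamma> \<turnstile> finsert (Forall x \<phi>) \<Delta>"
| ForallL: "finsert (\<phi>[z/x]) \<Gamma> \<turnstile> \<Delta> \<Longrightarrow> finsert (Forall x \<phi>) \<Gamma> \<turnstile> \<Delta>"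
| BoxR: "Box |`| \<Gamma> |\<union>| \<Delta> \<turnstile> {|\<phi>|} \<Longrightarrow> Box |`| \<Gamma> |\<union>| Box |`| \<Delta> \<turnstile> {|Box \<phi>|}"
| BoundL: "(\<And>n. \<Gamma> \<turnstile> finsert ((Dia ^^ n) Top) \<Delta>) \<Longrightarrow> \<Gamma> \<turnstile> \<Delta>"

definition kripke_frame :: "'w set \<Rightarrow> ('w \<times> 'w) set \<Rightarrow> bool" where
  "kripke_frame W R \<longleftrightarrow> W \<noteq> {} \<and> R \<subseteq> W \<times> W"

text \<open>The lists of length \<open>n\<close> in \<open>I w P\<close> form the interpretation at \<open>w\<close> of the \<open>n\<close>-ary
  predicate symbol named \<open>P\<close>.\<close>

definition kripke_model ::
  "'w set \<Rightarrow> ('w \<times> 'w) set \<Rightarrow> ('w \<Rightarrow> 'd set) \<Rightarrow> ('w \<Rightarrow> 'p \<Rightarrow> 'd list set) \<Rightarrow> bool" where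
  "kripke_model W R D I \<longleftrightarrow>
    kripke_frame W R \<and>
    (\<forall>w\<in>W. D w \<noteq> {}) \<and>
    (\<forall>w1 w2. (w1, w2) \<in> R \<longrightarrow> D w1 \<subseteq> D w2) \<and>
    (\<forall>w\<in>W. \<forall>P. I w P \<subseteq> lists (D w))"

primrec sat ::
  "('w \<times> 'w) set \<Rightarrow> ('w \<Rightarrow> 'd set) \<Rightarrow> ('w \<Rightarrow> 'p \<Rightarrow> 'd list set) \<Rightarrow> 'w \<Rightarrow> (var \<Rightarrow> 'd) \<Rightarrow> 'p fm \<Rightarrow> bool"
where
  "sat R D I w e Top \<longleftrightarrow> True"
| "sat R D I w e Bot \<longleftrightarrow> False"
| "sat R D I w e (Pred P xs) \<longleftrightarrow> map e xs \<in> I w P"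
| "sat R D I w e (And \<phi> \<psi>) \<longleftrightarrow> sat R D I w e \<phi> \<and> sat R D I w e \<psi>"
| "sat R D I w e (Neg \<phi>) \<longleftrightarrow> \<not> sat R D I w e \<phi>"
| "sat R D I w e (Imp \<phi> \<psi>) \<longleftrightarrow> (sat R D I w e \<phi> \<longrightarrow> sat R D I w e \<psi>)"
| "sat R D I w e (Forall x \<phi>) \<longleftrightarrow> (\<forall>d\<in>D w. sat R D I w (e(x := d)) \<phi>)"
| "sat R D I w e (Box \<phi>) \<longleftrightarrow> (\<forall>v. (w, v) \<in> R \<longrightarrow> sat R D I v e \<phi>)"

definition univ_closure :: "'p fm \<Rightarrow> 'p fm" where
  "univ_closure \<phi> = foldr Forall (sorted_list_of_set (fv \<phi>)) \<phi>"

text \<open>Since the universal closure is a closed formula, the assignment \<open>e\<close> below is immaterial.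
  Domains are subsets of \<open>'d\<close>, which is passed explicitly since it occurs in no other argument.\<close>

definition frame_valid :: "'d itself \<Rightarrow> 'w set \<Rightarrow> ('w \<times> 'w) set \<Rightarrow> 'p fm \<Rightarrow> bool" where
  "frame_valid (_ :: 'd itself) W R \<phi> \<longleftrightarrow>
    (\<forall>(D :: 'w \<Rightarrow> 'd set) I. kripke_model W R D I \<longrightarrow>
      (\<forall>w\<in>W. \<forall>e. sat R D I w e (univ_closure \<phi>)))"

definition bounded_length :: "'w set \<Rightarrow> ('w \<times> 'w) set \<Rightarrow> bool" where
  "bounded_length W R \<longleftrightarrow>
    (\<forall>w\<in>W. bdd_above {n::nat. \<exists>p. p 0 = w \<and> (\<forall>i<n. (p i, p (Suc i)) \<in> R)})"

definition BL :: "('w set \<times> ('w \<times> 'w) set) set" where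
  "BL = {(W, R). kripke_frame W R \<and> trans R \<and> bounded_length W R}"

text \<open>Validity over all frames of \<open>BL\<close> whose worlds, and all models whose domain elements, are drawn
  from the given types. Frames and models over a finite type embed into any infinite type, so that
  only infinite types need be considered.\<close>

definition BL_valid :: "'w itself \<Rightarrow> 'd itself \<Rightarrow> 'p fm \<Rightarrow> bool" where
  "BL_valid (_ :: 'w itself) (_ :: 'd itself) \<phi> \<longleftrightarrow>
    (\<forall>(W :: 'w set) R. (W, R) \<in> BL \<longrightarrow> frame_valid TYPE('d) W R \<phi>)"

end

theory Submission
  imports Defs "HOL-Library.Countable_Set"
begin

text \<open>For completeness, suppose that \<open>\<phi>\<close> is underivable. The boundedness rule gives an \<open>n\<close> for which
  \<open>\<rightarrow> \<phi>, \<diamond>\<^sup>n\<top>\<close> is underivable; this is the only place where that rule is needed. An underivable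
  pair of sets extends, by a Lindenbaum construction that adds a fresh witness for each universal
  formula put into the succedent, to a maximal underivable pair over a larger domain of variables.
  Maximality and the rules of the calculus make such a pair downward saturated, so cut is not needed.
  The (Box) rule provides a successor pair for each \<open>\<box>\<psi>\<close> in a succedent, and the transitive closure
  of the successor relation is the accessibility relation of a countermodel. A formula
  \<open>\<diamond>\<^bsup>m+1\<^esup>\<top>\<close> in the succedent of a world forces \<open>\<diamond>\<^sup>m\<top>\<close> into the succedents of its successors,
  whence all paths have length less than \<open>n\<close>.\<close>

section \<open>Substitution and satisfaction\<close>

lemma finite_fv [simp]: "finite (fv \<phi>)"
  by (induction \<phi>) auto

lemma fv_subset_vars: "fv \<phi> \<subseteq> vars \<phi>"
  by (induction \<phi>) auto

text \<open>The bound variable chosen by the quantifier clause of \<open>msubst\<close>, named so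
  that \<open>msubst_Forall\<close> can replace that clause and its \<open>let\<close> in all later
  proofs.\<close>

definition rename_bound :: "(var \<Rightarrow> var) \<Rightarrow> var \<Rightarrow> 'p fm \<Rightarrow> var" where
  "rename_bound \<sigma> x \<phi> =
    (if x \<in> \<sigma> ` (fv \<phi> - {x}) then LEAST u. u \<notin> \<sigma> ` (fv \<phi> - {x}) else x)"

lemma msubst_Forall:
  "msubst \<sigma> (Forall x \<phi>) = Forall (rename_bound \<sigma> x \<phi>) (msubst (\<sigma>(x := rename_bound \<sigma> x \<phi>)) \<phi>)"
  by (simp add: rename_bound_def Let_def)

lemma rename_bound_notin: "rename_bound \<sigma> x \<phi> \<notin> \<sigma> ` (fv \<phi> - {x})"
proof -
  have "\<exists>u. u \<notin> \<sigma> ` (fv \<phi> - {x})"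
    by (rule ex_new_if_finite) auto
  then have "(LEAST u. u \<notin> \<sigma> ` (fv \<phi> - {x})) \<notin> \<sigma> ` (fv \<phi> - {x})"
    by (rule LeastI_ex)
  then show ?thesis
    by (simp add: rename_bound_def)
qed

text \<open>By pigeonhole: \<open>{..card C}\<close> has one element more than \<open>C\<close> and
  so cannot lie inside it.\<close>

lemma Least_notin_le_card:
  fixes C :: "nat set"
  assumes "finite C"
  shows "(LEAST u. u \<notin> C) \<le> card C"
proof -
  have "\<not> {..card C} \<subseteq> C"
    using card_mono[OF assms, of "{..card C}"] by auto
  then obtain u where "u \<le> card C" "u \<notin> C"
    by auto
  then show ?thesis
    by (meson Least_le le_trans)
qed

text \<open>The bound is uniform in \<sigma>, as an image of \<open>fv \<phi> - {x}\<close> has at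
  most \<open>card (fv \<phi>)\<close> elements. Hence repeated substitution never pushes the bound
  variables past \<open>N\<close>.\<close>

lemma rename_bound_le:
  assumes "x \<le> N" "card (fv \<phi>) \<le> N"
  shows "rename_bound \<sigma> x \<phi> \<le> N"
proof -
  let ?C = "\<sigma> ` (fv \<phi> - {x})"
  have "(LEAST u. u \<notin> ?C) \<le> card ?C"
    by (rule Least_notin_le_card) simp
  also have "\<dots> \<le> card (fv \<phi> - {x})"
    by (rule card_image_le) simp
  also have "\<dots> \<le> card (fv \<phi>)"
    by (rule card_mono) auto
  finally show ?thesis
    using assms by (simp add: rename_bound_def)
qed

lemma fv_msubst: "fv (msubst \<sigma> \<phi>) = \<sigma> ` fv \<phi>"
proof (induction \<phi> arbitrary: \<sigma>)
  case (Forall x \<phi>)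
  let ?u = "rename_bound \<sigma> x \<phi>"
  have "fv (msubst \<sigma> (Forall x \<phi>)) = (\<sigma>(x := ?u)) ` fv \<phi> - {?u}"
    by (simp only: msubst_Forall fv.simps Forall)
  also have "\<dots> = \<sigma> ` (fv \<phi> - {x})"
    using rename_bound_notin[of \<sigma> x \<phi>] by (force split: if_splits)
  finally show ?case
    by simp
qed (auto simp del: msubst.simps(7) simp: msubst_Forall)

lemma set_fm_msubst [simp]: "set_fm (msubst \<sigma> \<phi>) = set_fm \<phi>"
  by (induction \<phi> arbitrary: \<sigma>) (auto simp: Let_def)

lemma fv_subst: "fv (subst \<phi> y x) \<subseteq> insert y (fv \<phi> - {x})"
  by (auto simp: subst_def fv_msubst)

text \<open>The measure for the truth lemma: renaming leaves it unchanged, so an instance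
  \<open>subst \<phi> y x\<close> counts as simpler than \<open>Forall x \<phi>\<close> although it
  is no subformula.\<close>

primrec depth :: "'p fm \<Rightarrow> nat" where
  "depth Top = 0"
| "depth Bot = 0"
| "depth (Pred P xs) = 0"
| "depth (And \<phi> \<psi>) = Suc (depth \<phi> + depth \<psi>)"
| "depth (Neg \<phi>) = Suc (depth \<phi>)"
| "depth (Imp \<phi> \<psi>) = Suc (depth \<phi> + depth \<psi>)"
| "depth (Forall x \<phi>) = Suc (depth \<phi>)"
| "depth (Box \<phi>) = Suc (depth \<phi>)"

lemma depth_msubst [simp]: "depth (msubst \<sigma> \<phi>) = depth \<phi>"
  by (induction \<phi> arbitrary: \<sigma>) (auto simp: Let_def)

lemma depth_subst [simp]: "depth (subst \<phi> y x) = depth \<phi>"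
  by (simp add: subst_def)

lemma sat_cong:
  "(\<And>x. x \<in> fv \<phi> \<Longrightarrow> e x = e' x) \<Longrightarrow> sat R D I w e \<phi> = sat R D I w e' \<phi>"
proof (induction \<phi> arbitrary: w e e')
  case (Pred P xs)
  then have "map e xs = map e' xs"
    by simp
  then show ?case
    by (simp del: map_eq_conv)
next
  case (And \<phi> \<psi>)
  have "sat R D I w e \<phi> = sat R D I w e' \<phi>" "sat R D I w e \<psi> = sat R D I w e' \<psi>"
    by (rule And.IH; use And.prems in simp)+
  then show ?case by simp
next
  case (Neg \<phi>)
  have "sat R D I w e \<phi> = sat R D I w e' \<phi>"
    by (rule Neg.IH; use Neg.prems in simp)
  then show ?case by simp
next
  case (Imp \<phi> \<psi>)
  have "sat R D I w e \<phi> = sat R D I w e' \<phi>" "sat R D I w e \<psi> = sat R D I w e' \<psi>"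
    by (rule Imp.IH; use Imp.prems in simp)+
  then show ?case by simp
next
  case (Forall x \<phi>)
  have "sat R D I w (e(x := d)) \<phi> = sat R D I w (e'(x := d)) \<phi>" for d
    by (rule Forall.IH) (use Forall.prems in simp)
  then show ?case by simp
next
  case (Box \<phi>)
  have "sat R D I v e \<phi> = sat R D I v e' \<phi>" for v
    by (rule Box.IH) (use Box.prems in simp)
  then show ?case by simp
qed auto

text \<open>In the quantifier case the new bound variable is not the image of any other free
  variable, so updating it changes the value of \<open>x\<close> alone.\<close>

lemma sat_msubst: "sat R D I w e (msubst \<sigma> \<phi>) = sat R D I w (e \<circ> \<sigma>) \<phi>"
proof (induction \<phi> arbitrary: w e \<sigma>)
  case (Forall x \<phi>)
  let ?u = "rename_bound \<sigma> x \<phi>"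
  have "sat R D I w (e(?u := d)) (msubst (\<sigma>(x := ?u)) \<phi>) = sat R D I w ((e \<circ> \<sigma>)(x := d)) \<phi>" for d
    unfolding Forall
    by (rule sat_cong) (use rename_bound_notin[of \<sigma> x \<phi>] in force)
  then show ?case
    by (simp add: msubst_Forall o_def del: msubst.simps(7))
qed (auto simp: o_def)

lemma sat_subst: "sat R D I w e (subst \<phi> y x) = sat R D I w (e(x := e y)) \<phi>"
  unfolding subst_def sat_msubst by (rule sat_cong) auto

lemma sat_foldr_Forall:
  "sat R D I w e (foldr Forall xs \<phi>) \<longleftrightarrow>
    (\<forall>e'. (\<forall>x\<in>set xs. e' x \<in> D w) \<longrightarrow> (\<forall>x. x \<notin> set xs \<longrightarrow> e' x = e x) \<longrightarrow> sat R D I w e' \<phi>)"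
  for e :: "var \<Rightarrow> 'd"
proof (induction xs arbitrary: e)
  case Nil
  have "e' = e" if "\<forall>x. e' x = e x" for e' :: "var \<Rightarrow> 'd"
    using that by auto
  then show ?case by auto
next
  case (Cons a xs)
  show ?case
  proof
    assume L: "sat R D I w e (foldr Forall (a # xs) \<phi>)"
    show "\<forall>e'. (\<forall>x\<in>set (a # xs). e' x \<in> D w) \<longrightarrow> (\<forall>x. x \<notin> set (a # xs) \<longrightarrow> e' x = e x)
        \<longrightarrow> sat R D I w e' \<phi>"
    proof (intro allI impI)
      fix e'
      assume "\<forall>x\<in>set (a # xs). e' x \<in> D w" "\<forall>x. x \<notin> set (a # xs) \<longrightarrow> e' x = e x"
      moreover from this L have "sat R D I w (e(a := e' a)) (foldr Forall xs \<phi>)"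
        by simp
      ultimately show "sat R D I w e' \<phi>"
        unfolding Cons.IH by auto
    qed
  next
    assume R: "\<forall>e'. (\<forall>x\<in>set (a # xs). e' x \<in> D w) \<longrightarrow> (\<forall>x. x \<notin> set (a # xs) \<longrightarrow> e' x = e x)
        \<longrightarrow> sat R D I w e' \<phi>"
    have "sat R D I w e' \<phi>"
      if "d \<in> D w" "\<forall>x\<in>set xs. e' x \<in> D w" "\<forall>x. x \<notin> set xs \<longrightarrow> e' x = (e(a := d)) x" for d e'
    proof -
      \<comment> \<open>If \<open>a\<close> occurs again in \<open>xs\<close>, an inner quantifier
        overrides \<open>d\<close>, but its value is taken from the domain as well.\<close>
      have "e' a \<in> D w"
        using that by (cases "a \<in> set xs") auto
      then show ?thesis
        using R that by auto
    qed
    then show "sat R D I w e (foldr Forall (a # xs) \<phi>)"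
      by (auto simp: Cons.IH)
  qed
qed

text \<open>Replaces the quantifier prefix by assignments with all values in the domain. Values of
  variables not free in \<phi> are irrelevant to truth; an element \<open>d\<close> of the domain
  serves as their default.\<close>

lemma sat_univ_closure:
  fixes D :: "'w \<Rightarrow> 'd set"
  assumes "D w \<noteq> {}"
  shows "sat R D I w e (univ_closure \<phi>) \<longleftrightarrow> (\<forall>e'. range e' \<subseteq> D w \<longrightarrow> sat R D I w e' \<phi>)"
proof -
  obtain d where d: "d \<in> D w"
    using assms by auto
  show ?thesis
    unfolding univ_closure_def sat_foldr_Forall
  proof (intro iffI allI impI)
    fix e' :: "var \<Rightarrow> 'd"
    assume *: "\<forall>e'. (\<forall>x\<in>set (sorted_list_of_set (fv \<phi>)). e' x \<in> D w) \<longrightarrow>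
        (\<forall>x. x \<notin> set (sorted_list_of_set (fv \<phi>)) \<longrightarrow> e' x = e x) \<longrightarrow> sat R D I w e' \<phi>"
      and "range e' \<subseteq> D w"
    then have "sat R D I w (\<lambda>x. if x \<in> fv \<phi> then e' x else e x) \<phi>"
      by (auto simp: image_subset_iff)
    then show "sat R D I w e' \<phi>"
      by (rule sat_cong[THEN iffD1, rotated]) auto
  next
    fix e'
    assume *: "\<forall>e'. range e' \<subseteq> D w \<longrightarrow> sat R D I w e' \<phi>"
      and "\<forall>x\<in>set (sorted_list_of_set (fv \<phi>)). e' x \<in> D w"
    then have "sat R D I w (\<lambda>x. if x \<in> fv \<phi> then e' x else d) \<phi>"
      using d by (auto simp: image_subset_iff)
    then show "sat R D I w e' \<phi>"
      by (rule sat_cong[THEN iffD1, rotated]) auto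
  qed
qed

section \<open>Soundness\<close>

lemma sat_Dia: "sat R D I w e (Dia \<phi>) \<longleftrightarrow> (\<exists>v. (w, v) \<in> R \<and> sat R D I v e \<phi>)"
  by (simp add: Dia_def)

lemma sat_Dia_pow_path:
  "sat R D I w e ((Dia ^^ n) Top) \<Longrightarrow> \<exists>p. p 0 = w \<and> (\<forall>i<n. (p i, p (Suc i)) \<in> R)"
proof (induction n arbitrary: w)
  case (Suc n)
  then obtain v where v: "(w, v) \<in> R" "sat R D I v e ((Dia ^^ n) Top)"
    by (auto simp: sat_Dia)
  from Suc.IH[OF v(2)] obtain p where p: "p 0 = v" "\<forall>i<n. (p i, p (Suc i)) \<in> R"
    by auto
  have "\<forall>i<Suc n. (case_nat w p i, case_nat w p (Suc i)) \<in> R"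
    using p v(1) by (auto split: nat.split)
  then show ?case
    by (intro exI[of _ "case_nat w p"]) simp
qed (auto intro: exI[of _ "\<lambda>_. w"])

text \<open>By induction on the derivation, with world and assignment arbitrary:
  \<open>ForallR\<close> changes the assignment and \<open>BoxR\<close> the world. Growing domains
  keep the assignment admissible at successors, transitivity carries boxed formulas to them, and for
  \<open>BoundL\<close> a world refuting the conclusion would start paths of every length.\<close>

lemma soundness:
  assumes "\<Gamma> \<turnstile> \<Delta>" and model: "kripke_model W R D I" and "trans R" and bl: "bounded_length W R"
  shows "w \<in> W \<Longrightarrow> range e \<subseteq> D w \<Longrightarrow> (\<And>\<gamma>. \<gamma> |\<in>| \<Gamma> \<Longrightarrow> sat R D I w e \<gamma>)
    \<Longrightarrow> \<exists>\<delta>. \<delta> |\<in>| \<Delta> \<and> sat R D I w e \<delta>"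
  using assms(1)
proof (induction arbitrary: w e rule: derivable.induct)
  case (Weak \<Gamma> \<Delta> \<Gamma>' \<Delta>')
  have "\<exists>\<delta>. \<delta> |\<in>| \<Delta> \<and> sat R D I w e \<delta>"
    by (rule Weak.IH) (use Weak.prems Weak.hyps in auto)
  then show ?case using Weak.hyps by auto
next
  case (AndR \<Gamma> \<phi> \<Delta> \<psi>)
  from AndR.IH(1)[OF AndR.prems] AndR.IH(2)[OF AndR.prems] show ?case by auto
next
  case (AndL1 \<phi> \<Gamma> \<Delta> \<psi>)
  show ?case
    by (rule AndL1.IH) (use AndL1.prems AndL1.prems(3)[of "And \<phi> \<psi>"] in auto)
next
  case (AndL2 \<psi> \<Gamma> \<Delta> \<phi>)
  show ?case
    by (rule AndL2.IH) (use AndL2.prems AndL2.prems(3)[of "And \<phi> \<psi>"] in auto)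
next
  case (ImpR \<phi> \<Gamma> \<psi> \<Delta>)
  show ?case
  proof (cases "sat R D I w e \<phi>")
    case True
    have "\<exists>\<delta>. \<delta> |\<in>| finsert \<psi> \<Delta> \<and> sat R D I w e \<delta>"
      by (rule ImpR.IH) (use ImpR.prems True in auto)
    then show ?thesis by auto
  qed auto
next
  case (ImpL \<Gamma> \<phi> \<Delta> \<psi> \<Lambda> \<Xi>)
  have "\<exists>\<delta>. \<delta> |\<in>| finsert \<phi> \<Delta> \<and> sat R D I w e \<delta>"
    by (rule ImpL.IH(1)) (use ImpL.prems in auto)
  moreover have "\<exists>\<delta>. \<delta> |\<in>| \<Xi> \<and> sat R D I w e \<delta>" if "sat R D I w e \<phi>"
    by (rule ImpL.IH(2)) (use ImpL.prems(1,2) ImpL.prems(3)[of "Imp \<phi> \<psi>"] ImpL.prems(3) that in auto)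
  ultimately show ?case by auto
next
  case (NegR \<phi> \<Gamma> \<Delta>)
  show ?case
  proof (cases "sat R D I w e \<phi>")
    case True
    have "\<exists>\<delta>. \<delta> |\<in>| \<Delta> \<and> sat R D I w e \<delta>"
      by (rule NegR.IH) (use NegR.prems True in auto)
    then show ?thesis by auto
  qed auto
next
  case (NegL \<Gamma> \<phi> \<Delta>)
  have "\<exists>\<delta>. \<delta> |\<in>| finsert \<phi> \<Delta> \<and> sat R D I w e \<delta>"
    by (rule NegL.IH) (use NegL.prems in auto)
  then show ?case using NegL.prems(3)[of "Neg \<phi>"] by auto
next
  case (ForallR \<Gamma> \<phi> y x \<Delta>)
  have fresh: "y \<notin> fv \<psi>" if "\<psi> |\<in>| \<Gamma> |\<union>| finsert (Forall x \<phi>) \<Delta>" for \<psi>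
    using ForallR.hyps(2) that fv_subset_vars by blast
  have yx: "y \<notin> fv \<phi> - {x}"
    using fresh[of "Forall x \<phi>"] by simp
  have upd: "sat R D I w (e(y := d)) \<psi> = sat R D I w e \<psi>"
    if "\<psi> |\<in>| \<Gamma> |\<union>| finsert (Forall x \<phi>) \<Delta>" for \<psi> d
    by (rule sat_cong) (use fresh[OF that] in auto)
  show ?case
  proof (rule ccontr)
    assume no: "\<not> ?case"
    \<comment> \<open>The fresh variable \<open>y\<close> is made to denote \<open>d\<close>. This
      affects no formula of the lower sequent, so the premise can only be satisfied through the
      instance.\<close>
    have "sat R D I w (e(x := d)) \<phi>" if "d \<in> D w" for d
    proof -
      have "\<exists>\<delta>. \<delta> |\<in>| finsert (subst \<phi> y x) \<Delta> \<and> sat R D I w (e(y := d)) \<delta>"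
      proof (rule ForallR.IH)
        show "range (e(y := d)) \<subseteq> D w"
          using ForallR.prems(2) that by auto
        show "sat R D I w (e(y := d)) \<gamma>" if "\<gamma> |\<in>| \<Gamma>" for \<gamma>
          using that ForallR.prems(3) upd[of \<gamma> d] by simp
      qed (rule ForallR.prems(1))
      then have "sat R D I w (e(y := d)) (subst \<phi> y x)"
        using no upd by auto
      then show ?thesis
        unfolding sat_subst by (rule sat_cong[THEN iffD1, rotated]) (use yx in auto)
    qed
    then show False
      using no by auto
  qed
next
  case (ForallL \<phi> z x \<Gamma> \<Delta>)
  show ?case
  proof (rule ForallL.IH)
    fix \<gamma> assume "\<gamma> |\<in>| finsert (subst \<phi> z x) \<Gamma>"
    moreover have "e z \<in> D w"
      using ForallL.prems(2) by auto
    ultimately show "sat R D I w e \<gamma>"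
      using ForallL.prems(3)[of "Forall x \<phi>"] ForallL.prems(3)[of \<gamma>]
      by (auto simp: sat_subst)
  qed (use ForallL.prems in auto)
next
  case (BoxR \<Gamma> \<Delta> \<phi>)
  have "sat R D I v e \<phi>" if v: "(w, v) \<in> R" for v
  proof -
    have "\<exists>\<delta>. \<delta> |\<in>| {|\<phi>|} \<and> sat R D I v e \<delta>"
    proof (rule BoxR.IH)
      show "v \<in> W" "range e \<subseteq> D v"
        using v model BoxR.prems(2) unfolding kripke_model_def kripke_frame_def by blast+
      fix \<gamma> assume "\<gamma> |\<in>| Box |`| \<Gamma> |\<union>| \<Delta>"
      then consider \<alpha> where "\<gamma> = Box \<alpha>" "\<alpha> |\<in>| \<Gamma>" | "\<gamma> |\<in>| \<Delta>"
        by auto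
      then show "sat R D I v e \<gamma>"
      proof cases
        case 1
        then have "sat R D I w e (Box \<alpha>)"
          by (intro BoxR.prems(3)) auto
        then show ?thesis
          using 1 v \<open>trans R\<close> by (auto dest: transD)
      next
        case 2
        then have "sat R D I w e (Box \<gamma>)"
          by (intro BoxR.prems(3)) auto
        then show ?thesis
          using v by auto
      qed
    qed
    then show ?thesis by auto
  qed
  then show ?case by auto
next
  case (BoundL \<Gamma> \<Delta>)
  show ?case
  proof (rule ccontr)
    assume no: "\<not> ?case"
    have "sat R D I w e ((Dia ^^ n) Top)" for n
      using BoundL.IH[OF BoundL.prems, of n] no by auto
    then have path: "\<exists>p. p 0 = w \<and> (\<forall>i<n. (p i, p (Suc i)) \<in> R)" for n
      by (rule sat_Dia_pow_path)
    have "bdd_above {n::nat. \<exists>p. p 0 = w \<and> (\<forall>i<n. (p i, p (Suc i)) \<in> R)}"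
      using bl BoundL.prems(1) unfolding bounded_length_def by simp
    then obtain m where "\<forall>n\<in>{n::nat. \<exists>p. p 0 = w \<and> (\<forall>i<n. (p i, p (Suc i)) \<in> R)}. n \<le> m"
      unfolding bdd_above_def ..
    from this[unfolded mem_Collect_eq Ball_def, rule_format, OF path[of "Suc m"]] show False
      by simp
  qed
qed auto

section \<open>Consistent pairs\<close>

text \<open>Sequents are finite whereas the pairs built below are infinite, so underivability is
  required of every finite subsequent. This gives the notion finite character despite the infinitary
  rule.\<close>

definition consistent :: "'p fm set \<Rightarrow> 'p fm set \<Rightarrow> bool" where
  "consistent \<Gamma> \<Delta> \<longleftrightarrow> (\<forall>G H. fset G \<subseteq> \<Gamma> \<longrightarrow> fset H \<subseteq> \<Delta> \<longrightarrow> \<not> G \<turnstile> H)"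

lemma consistent_mono:
  "consistent \<Gamma>' \<Delta>' \<Longrightarrow> \<Gamma> \<subseteq> \<Gamma>' \<Longrightarrow> \<Delta> \<subseteq> \<Delta>' \<Longrightarrow> consistent \<Gamma> \<Delta>"
  unfolding consistent_def by blast

lemma inconsistentI: "G \<turnstile> H \<Longrightarrow> fset G \<subseteq> \<Gamma> \<Longrightarrow> fset H \<subseteq> \<Delta> \<Longrightarrow> \<not> consistent \<Gamma> \<Delta>"
  unfolding consistent_def by blast

text \<open>The derivable subsequent may or may not contain \<phi>; removing it and weakening it
  back in displays it in the form of a rule premise.\<close>

lemma inconsistent_insert_leftE:
  assumes "\<not> consistent (insert \<phi> \<Gamma>) \<Delta>"
  obtains G H where "finsert \<phi> G \<turnstile> H" "fset G \<subseteq> \<Gamma>" "fset H \<subseteq> \<Delta>"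
proof -
  obtain G H where GH: "G \<turnstile> H" "fset G \<subseteq> insert \<phi> \<Gamma>" "fset H \<subseteq> \<Delta>"
    using assms unfolding consistent_def by blast
  have "finsert \<phi> (G |-| {|\<phi>|}) \<turnstile> H"
    by (rule Weak[OF GH(1)]) auto
  then show thesis
    using GH by (intro that[of "G |-| {|\<phi>|}" H]) auto
qed

lemma inconsistent_insert_rightE:
  assumes "\<not> consistent \<Gamma> (insert \<phi> \<Delta>)"
  obtains G H where "G \<turnstile> finsert \<phi> H" "fset G \<subseteq> \<Gamma>" "fset H \<subseteq> \<Delta>"
proof -
  obtain G H where GH: "G \<turnstile> H" "fset G \<subseteq> \<Gamma>" "fset H \<subseteq> insert \<phi> \<Delta>"
    using assms unfolding consistent_def by blast
  have "G \<turnstile> finsert \<phi> (H |-| {|\<phi>|})"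
    by (rule Weak[OF GH(1)]) auto
  then show thesis
    using GH by (intro that[of G "H |-| {|\<phi>|}"]) auto
qed

text \<open>This lemma and its companions up to \<open>consistent_Forall_right\<close> read one rule
  each from conclusion to premise. The principal formula already belongs to the pair, so the
  conclusion of the rule would be a derivable subsequent of it.\<close>

lemma consistent_And_left:
  assumes "consistent \<Gamma> \<Delta>" "And \<phi> \<psi> \<in> \<Gamma>"
  shows "consistent (insert \<phi> \<Gamma>) \<Delta>" "consistent (insert \<psi> \<Gamma>) \<Delta>"
proof -
  show "consistent (insert \<phi> \<Gamma>) \<Delta>"
  proof (rule ccontr)
    assume "\<not> consistent (insert \<phi> \<Gamma>) \<Delta>"
    then obtain G H where "finsert \<phi> G \<turnstile> H" "fset G \<subseteq> \<Gamma>" "fset H \<subseteq> \<Delta>"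
      by (rule inconsistent_insert_leftE)
    then show False
      using inconsistentI[OF AndL1[of \<phi> G H \<psi>], of \<Gamma> \<Delta>] assms by auto
  qed
  show "consistent (insert \<psi> \<Gamma>) \<Delta>"
  proof (rule ccontr)
    assume "\<not> consistent (insert \<psi> \<Gamma>) \<Delta>"
    then obtain G H where "finsert \<psi> G \<turnstile> H" "fset G \<subseteq> \<Gamma>" "fset H \<subseteq> \<Delta>"
      by (rule inconsistent_insert_leftE)
    then show False
      using inconsistentI[OF AndL2[of \<psi> G H \<phi>], of \<Gamma> \<Delta>] assms by auto
  qed
qed

lemma consistent_And_right:
  assumes "consistent \<Gamma> \<Delta>" "And \<phi> \<psi> \<in> \<Delta>"
  shows "consistent \<Gamma> (insert \<phi> \<Delta>) \<or> consistent \<Gamma> (insert \<psi> \<Delta>)"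
proof (rule ccontr)
  assume "\<not> ?thesis"
  then obtain G H G' H' where
    *: "G \<turnstile> finsert \<phi> H" "fset G \<subseteq> \<Gamma>" "fset H \<subseteq> \<Delta>" "G' \<turnstile> finsert \<psi> H'" "fset G' \<subseteq> \<Gamma>" "fset H' \<subseteq> \<Delta>"
    by (metis inconsistent_insert_rightE)
  \<comment> \<open>\<open>AndR\<close> has a common context, so both derivations are first weakened
    to the union of theirs.\<close>
  have "G |\<union>| G' \<turnstile> finsert (And \<phi> \<psi>) (H |\<union>| H')"
    by (rule AndR; rule Weak[OF *(1)] Weak[OF *(4)]) auto
  from inconsistentI[OF this, of \<Gamma> \<Delta>] show False
    using assms * by auto
qed

lemma consistent_Imp_left:
  assumes "consistent \<Gamma> \<Delta>" "Imp \<phi> \<psi> \<in> \<Gamma>"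
  shows "consistent \<Gamma> (insert \<phi> \<Delta>) \<or> consistent (insert \<psi> \<Gamma>) \<Delta>"
proof (rule ccontr)
  assume "\<not> ?thesis"
  then obtain G H G' H' where
    *: "G \<turnstile> finsert \<phi> H" "fset G \<subseteq> \<Gamma>" "fset H \<subseteq> \<Delta>" "finsert \<psi> G' \<turnstile> H'" "fset G' \<subseteq> \<Gamma>" "fset H' \<subseteq> \<Delta>"
    by (metis inconsistent_insert_rightE inconsistent_insert_leftE)
  show False
    using inconsistentI[OF ImpL[OF *(1,4)], of \<Gamma> \<Delta>] assms * by auto
qed

lemma consistent_Imp_right:
  assumes "consistent \<Gamma> \<Delta>" "Imp \<phi> \<psi> \<in> \<Delta>"
  shows "consistent (insert \<phi> \<Gamma>) (insert \<psi> \<Delta>)"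
proof (rule ccontr)
  assume "\<not> ?thesis"
  then obtain G H where *: "finsert \<phi> G \<turnstile> H" "fset G \<subseteq> \<Gamma>" "fset H \<subseteq> insert \<psi> \<Delta>"
    by (rule inconsistent_insert_leftE)
  have "finsert \<phi> G \<turnstile> finsert \<psi> (H |-| {|\<psi>|})"
    by (rule Weak[OF *(1)]) auto
  from inconsistentI[OF ImpR[OF this], of \<Gamma> \<Delta>] show False
    using assms * by auto
qed

lemma consistent_Neg_left:
  assumes "consistent \<Gamma> \<Delta>" "Neg \<phi> \<in> \<Gamma>"
  shows "consistent \<Gamma> (insert \<phi> \<Delta>)"
proof (rule ccontr)
  assume "\<not> ?thesis"
  then obtain G H where *: "G \<turnstile> finsert \<phi> H" "fset G \<subseteq> \<Gamma>" "fset H \<subseteq> \<Delta>"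
    by (rule inconsistent_insert_rightE)
  from inconsistentI[OF NegL[OF *(1)], of \<Gamma> \<Delta>] show False
    using assms * by auto
qed

lemma consistent_Neg_right:
  assumes "consistent \<Gamma> \<Delta>" "Neg \<phi> \<in> \<Delta>"
  shows "consistent (insert \<phi> \<Gamma>) \<Delta>"
proof (rule ccontr)
  assume "\<not> ?thesis"
  then obtain G H where *: "finsert \<phi> G \<turnstile> H" "fset G \<subseteq> \<Gamma>" "fset H \<subseteq> \<Delta>"
    by (rule inconsistent_insert_leftE)
  from inconsistentI[OF NegR[OF *(1)], of \<Gamma> \<Delta>] show False
    using assms * by auto
qed

lemma consistent_Forall_left:
  assumes "consistent \<Gamma> \<Delta>" "Forall x \<phi> \<in> \<Gamma>"
  shows "consistent (insert (subst \<phi> z x) \<Gamma>) \<Delta>"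
proof (rule ccontr)
  assume "\<not> ?thesis"
  then obtain G H where *: "finsert (subst \<phi> z x) G \<turnstile> H" "fset G \<subseteq> \<Gamma>" "fset H \<subseteq> \<Delta>"
    by (rule inconsistent_insert_leftE)
  from inconsistentI[OF ForallL[OF *(1)], of \<Gamma> \<Delta>] show False
    using assms * by auto
qed

text \<open>The eigenvariable must be absent, even as a bound variable, from the whole infinite
  pair. Securing such variables is the purpose of the bounds on binders and of the reserved
  variables below.\<close>

lemma consistent_Forall_right:
  assumes "consistent \<Gamma> \<Delta>" "Forall x \<phi> \<in> \<Delta>" "\<And>\<psi>. \<psi> \<in> \<Gamma> \<union> \<Delta> \<Longrightarrow> y \<notin> vars \<psi>"
  shows "consistent \<Gamma> (insert (subst \<phi> y x) \<Delta>)"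
proof (rule ccontr)
  assume "\<not> ?thesis"
  then obtain G H where *: "G \<turnstile> finsert (subst \<phi> y x) H" "fset G \<subseteq> \<Gamma>" "fset H \<subseteq> \<Delta>"
    by (rule inconsistent_insert_rightE)
  have "\<forall>\<psi>. \<psi> |\<in>| G |\<union>| finsert (Forall x \<phi>) H \<longrightarrow> y \<notin> vars \<psi>"
    using * assms(2,3) by blast
  from inconsistentI[OF ForallR[OF *(1) this], of \<Gamma> \<Delta>] show False
    using assms * by auto
qed

definition unbox :: "'p fm set \<Rightarrow> 'p fm set" where
  "unbox \<Gamma> = {\<gamma>. Box \<gamma> \<in> \<Gamma>}"

lemma consistent_Box_right:
  assumes "consistent \<Gamma> \<Delta>" "Box \<phi> \<in> \<Delta>"
  shows "consistent (unbox \<Gamma> \<union> Box ` unbox \<Gamma>) {\<phi>}"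
proof (rule ccontr)
  assume "\<not> ?thesis"
  then obtain G H where *: "G \<turnstile> H" "fset G \<subseteq> unbox \<Gamma> \<union> Box ` unbox \<Gamma>" "fset H \<subseteq> {\<phi>}"
    unfolding consistent_def by blast
  \<comment> \<open>\<open>U\<close> collects the bodies of the boxed formulas in \<open>G\<close>
    together with the members of \<open>G\<close> that may occur unboxed. Then \<open>G\<close> is
    covered by \<open>U\<close> and its boxes, and \<open>BoxR\<close> applies with \<open>U\<close>
    in both of its roles.\<close>
  have "finite (unbox \<Gamma> \<inter> (fset G \<union> Box -` fset G))"
    by (intro finite_Int disjI2 finite_UnI finite_vimageI) (auto intro: injI)
  then obtain U where U: "fset U = unbox \<Gamma> \<inter> (fset G \<union> Box -` fset G)"
    by (metis fset_cases fset mem_Collect_eq Abs_fset_inverse)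
  have "fset G \<subseteq> fset (Box |`| U |\<union>| U)"
    using *(2) U by auto
  moreover have "fset H \<subseteq> fset {|\<phi>|}"
    using *(3) by simp
  ultimately have "Box |`| U |\<union>| U \<turnstile> {|\<phi>|}"
    using Weak[OF *(1)] by (simp only: less_eq_fset.rep_eq)
  from BoxR[OF this] show False
    by (rule inconsistentI[THEN notE]) (use U assms in \<open>auto simp: unbox_def\<close>)
qed

section \<open>Fragments with bounded bound variables\<close>

text \<open>Renaming a bound variable of \<open>\<forall>x \<phi>\<close> picks a variable at most the number of free variables of
  \<open>\<phi>\<close>. So below a suitable \<open>N\<close> the bound variables of a formula and of all its substitution
  instances stay below \<open>N\<close>, and every variable above \<open>N\<close> can serve as a witness.\<close>

primrec binders_le :: "nat \<Rightarrow> 'p fm \<Rightarrow> bool" where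
  "binders_le N Top \<longleftrightarrow> True"
| "binders_le N Bot \<longleftrightarrow> True"
| "binders_le N (Pred P xs) \<longleftrightarrow> True"
| "binders_le N (And \<phi> \<psi>) \<longleftrightarrow> binders_le N \<phi> \<and> binders_le N \<psi>"
| "binders_le N (Neg \<phi>) \<longleftrightarrow> binders_le N \<phi>"
| "binders_le N (Imp \<phi> \<psi>) \<longleftrightarrow> binders_le N \<phi> \<and> binders_le N \<psi>"
| "binders_le N (Forall x \<phi>) \<longleftrightarrow> x \<le> N \<and> card (fv \<phi>) \<le> N \<and> binders_le N \<phi>"
| "binders_le N (Box \<phi>) \<longleftrightarrow> binders_le N \<phi>"

lemma binders_le_mono: "binders_le N \<phi> \<Longrightarrow> N \<le> M \<Longrightarrow> binders_le M \<phi>"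
  by (induction \<phi>) auto

lemma ex_binders_le: "\<exists>N. binders_le N \<phi>"
proof (induction \<phi>)
  case (And \<phi> \<psi>)
  then obtain M N where "binders_le M \<phi>" "binders_le N \<psi>" by auto
  then show ?case
    by (intro exI[of _ "max M N"]) (auto intro: binders_le_mono)
next
  case (Imp \<phi> \<psi>)
  then obtain M N where "binders_le M \<phi>" "binders_le N \<psi>" by auto
  then show ?case
    by (intro exI[of _ "max M N"]) (auto intro: binders_le_mono)
next
  case (Forall x \<phi>)
  then obtain M where "binders_le M \<phi>" by auto
  then show ?case
    by (intro exI[of _ "M + x + card (fv \<phi>)"]) (auto intro: binders_le_mono)
qed auto

text \<open>A substitution can identify free variables but not multiply them, so the cardinality
  condition in \<open>binders_le\<close> survives it.\<close>

lemma binders_le_msubst: "binders_le N \<phi> \<Longrightarrow> binders_le N (msubst \<sigma> \<phi>)"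
proof (induction \<phi> arbitrary: \<sigma>)
  case (Forall x \<phi>)
  have "card (\<tau> ` fv \<phi>) \<le> N" for \<tau> :: "var \<Rightarrow> var"
    using Forall.prems card_image_le[OF finite_fv, of \<tau> \<phi>] by simp
  then show ?case
    using Forall rename_bound_le[of x N \<phi> \<sigma>]
    by (simp add: msubst_Forall fv_msubst del: msubst.simps(7) fun_upd_apply)
qed auto

lemma vars_subset_binders_le: "binders_le N \<phi> \<Longrightarrow> vars \<phi> \<subseteq> fv \<phi> \<union> {..N}"
  by (induction \<phi>) auto

lemma binders_le_Dia_pow: "binders_le N ((Dia ^^ n) Top)"
  by (induction n) (auto simp: Dia_def)

lemma fv_Dia_pow: "fv ((Dia ^^ n) Top) = {}"
  by (induction n) (auto simp: Dia_def)

lemma set_fm_Dia_pow: "set_fm ((Dia ^^ n) Top) = {}"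
  by (induction n) (auto simp: Dia_def)

text \<open>\<open>N\<close> keeps large variables usable as witnesses, \<open>S\<close> confines
  the predicate names so that the set is countable for any type \<open>'p\<close>, and
  \<open>D\<close> is the domain of a world.\<close>

definition fragment :: "nat \<Rightarrow> 'p set \<Rightarrow> var set \<Rightarrow> 'p fm set" where
  "fragment N S D = {\<chi>. binders_le N \<chi> \<and> set_fm \<chi> \<subseteq> S \<and> fv \<chi> \<subseteq> D}"

lemma fragment_simps [simp]:
  "Top \<in> fragment N S D"
  "And \<phi> \<psi> \<in> fragment N S D \<longleftrightarrow> \<phi> \<in> fragment N S D \<and> \<psi> \<in> fragment N S D"
  "Imp \<phi> \<psi> \<in> fragment N S D \<longleftrightarrow> \<phi> \<in> fragment N S D \<and> \<psi> \<in> fragment N S D"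
  "Neg \<phi> \<in> fragment N S D \<longleftrightarrow> \<phi> \<in> fragment N S D"
  "Box \<phi> \<in> fragment N S D \<longleftrightarrow> \<phi> \<in> fragment N S D"
  by (auto simp: fragment_def)

lemma fragment_mono: "D \<subseteq> D' \<Longrightarrow> fragment N S D \<subseteq> fragment N S D'"
  by (auto simp: fragment_def)

lemma subst_in_fragment:
  "Forall x \<phi> \<in> fragment N S D \<Longrightarrow> z \<in> D \<Longrightarrow> subst \<phi> z x \<in> fragment N S D"
  using fv_subst[of \<phi> z x] by (auto simp: fragment_def subst_def binders_le_msubst)

instance fm :: (countable) countable
  by countable_datatype

text \<open>Every formula with predicate names in \<open>S\<close> is the image under
  \<open>map_fm\<close> of a formula over natural numbers, and those are countable. Inserting
  \<open>undefined\<close> makes the enumerated set nonempty.\<close>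

lemma countable_fragment:
  fixes S :: "'p set"
  assumes "countable S"
  shows "countable (fragment N S D)"
proof -
  let ?f = "from_nat_into (insert undefined S) :: nat \<Rightarrow> 'p"
  have rng: "range ?f = insert undefined S"
    by (rule range_from_nat_into) (use assms in auto)
  have "\<chi> \<in> range (map_fm ?f)" if "set_fm \<chi> \<subseteq> S" for \<chi>
  proof -
    have "map_fm ?f (map_fm (inv ?f) \<chi>) = map_fm id \<chi>"
      unfolding fm.map_comp
      by (rule fm.map_cong0) (use that rng in \<open>auto intro!: f_inv_into_f\<close>)
    then show ?thesis
      by (metis fm.map_id rangeI)
  qed
  then have "fragment N S D \<subseteq> range (map_fm ?f)"
    by (auto simp: fragment_def)
  then show ?thesis
    by (rule countable_subset) auto
qed

section \<open>Maximal pairs\<close>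

datatype 'p world = World (ant: "'p fm set") (suc: "'p fm set") (dom: "var set")

definition maximal :: "nat \<Rightarrow> 'p set \<Rightarrow> 'p world \<Rightarrow> bool" where
  "maximal N S w \<longleftrightarrow>
    consistent (ant w) (suc w) \<and>
    ant w \<union> suc w \<subseteq> fragment N S (dom w) \<and>
    dom w \<noteq> {} \<and> infinite (- dom w) \<and>
    (\<forall>\<chi>\<in>fragment N S (dom w). consistent (insert \<chi> (ant w)) (suc w) \<longrightarrow> \<chi> \<in> ant w) \<and>
    (\<forall>\<chi>\<in>fragment N S (dom w). consistent (ant w) (insert \<chi> (suc w)) \<longrightarrow> \<chi> \<in> suc w) \<and>
    (\<forall>x \<phi>. Forall x \<phi> \<in> suc w \<longrightarrow> (\<exists>y\<in>dom w. subst \<phi> y x \<in> suc w))"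

text \<open>What one stage of the construction achieves for \<chi>, with witnesses from the reserve
  \<open>F\<close>. The first two clauses survive any enlargement of the pair, because enlarging can
  only destroy consistency.\<close>

definition decides :: "var set \<Rightarrow> 'p fm \<Rightarrow> 'p fm set \<Rightarrow> 'p fm set \<Rightarrow> bool" where
  "decides F \<chi> \<Gamma> \<Delta> \<longleftrightarrow>
    (consistent (insert \<chi> \<Gamma>) \<Delta> \<longrightarrow> \<chi> \<in> \<Gamma>) \<and>
    (consistent \<Gamma> (insert \<chi> \<Delta>) \<longrightarrow> \<chi> \<in> \<Delta>) \<and>
    (\<forall>x \<phi>. \<chi> = Forall x \<phi> \<longrightarrow> \<chi> \<in> \<Delta> \<longrightarrow> (\<exists>y\<in>F. subst \<phi> y x \<in> \<Delta>))"

lemma lindenbaum_step: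
  assumes con: "consistent \<Gamma> \<Delta>" and sub: "\<Gamma> \<union> \<Delta> \<subseteq> fragment N S (E \<union> V)"
    and V: "finite V" "V \<subseteq> F" and F: "infinite F" "F \<inter> (E \<union> {..N}) = {}"
    and \<chi>: "\<chi> \<in> fragment N S (E \<union> F)"
  shows "\<exists>\<Gamma>' \<Delta>' V'. consistent \<Gamma>' \<Delta>' \<and> \<Gamma>' \<union> \<Delta>' \<subseteq> fragment N S (E \<union> V') \<and> finite V' \<and> V' \<subseteq> F \<and>
    \<Gamma> \<subseteq> \<Gamma>' \<and> \<Delta> \<subseteq> \<Delta>' \<and> decides F \<chi> \<Gamma>' \<Delta>'"
proof -
  define V1 where "V1 = V \<union> (fv \<chi> \<inter> F)"
  define \<Gamma>1 where "\<Gamma>1 = (if consistent (insert \<chi> \<Gamma>) \<Delta> then insert \<chi> \<Gamma> else \<Gamma>)"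
  \<comment> \<open>The right side is tested against the already extended \<open>\<Gamma>1\<close>,
    so both additions are consistent jointly.\<close>
  define \<Delta>1 where "\<Delta>1 = (if consistent \<Gamma>1 (insert \<chi> \<Delta>) then insert \<chi> \<Delta> else \<Delta>)"
  have con1: "consistent \<Gamma>1 \<Delta>1"
    using con by (auto simp: \<Gamma>1_def \<Delta>1_def)
  have V1: "finite V1" "V1 \<subseteq> F"
    using V by (auto simp: V1_def)
  have \<chi>1: "\<chi> \<in> fragment N S (E \<union> V1)"
    using \<chi> by (auto simp: fragment_def V1_def)
  have "fragment N S (E \<union> V) \<subseteq> fragment N S (E \<union> V1)"
    by (rule fragment_mono) (auto simp: V1_def)
  then have sub1: "\<Gamma>1 \<union> \<Delta>1 \<subseteq> fragment N S (E \<union> V1)"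
    using sub \<chi>1 by (auto simp: \<Gamma>1_def \<Delta>1_def)
  have ext1: "\<Gamma> \<subseteq> \<Gamma>1" "\<Delta> \<subseteq> \<Delta>1"
    by (auto simp: \<Gamma>1_def \<Delta>1_def)
  \<comment> \<open>Stated for larger succedents too, since a witness instance may still be added to
    \<open>\<Delta>1\<close>.\<close>
  have max_left: "\<chi> \<in> \<Gamma>1" if "consistent (insert \<chi> \<Gamma>1) \<Delta>'" "\<Delta> \<subseteq> \<Delta>'" for \<Delta>'
    using consistent_mono[OF that(1), of "insert \<chi> \<Gamma>" \<Delta>] that(2) by (force simp: \<Gamma>1_def)
  have max_right: "\<chi> \<in> \<Delta>1" if "consistent \<Gamma>1 (insert \<chi> \<Delta>')" "\<Delta> \<subseteq> \<Delta>'" for \<Delta>'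
    using consistent_mono[OF that(1), of \<Gamma>1 "insert \<chi> \<Delta>"] that(2) by (force simp: \<Delta>1_def)
  show ?thesis
  proof (cases "\<exists>x \<phi>. \<chi> = Forall x \<phi> \<and> \<chi> \<in> \<Delta>1")
    case False
    then have "decides F \<chi> \<Gamma>1 \<Delta>1"
      using max_left max_right ext1 unfolding decides_def by blast
    then show ?thesis
      using con1 sub1 V1 ext1 by blast
  next
    case True
    then obtain x \<phi> where x: "\<chi> = Forall x \<phi>" "\<chi> \<in> \<Delta>1"
      by auto
    have "infinite (F - V1)"
      using F(1) V1(1) by simp
    \<comment> \<open>Being in \<open>F\<close>, \<open>y\<close> lies above \<open>N\<close> and
      outside \<open>E\<close>, so it is bound in no formula of the pair; being outside
      \<open>V1\<close>, it is not free in any either.\<close>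
    then obtain y where y: "y \<in> F" "y \<notin> V1"
      by (metis DiffE finite.emptyI ex_in_conv)
    define \<Delta>2 where "\<Delta>2 = insert (subst \<phi> y x) \<Delta>1"
    have "y \<notin> vars \<psi>" if "\<psi> \<in> \<Gamma>1 \<union> \<Delta>1" for \<psi>
    proof -
      have "binders_le N \<psi>" "fv \<psi> \<subseteq> E \<union> V1"
        using that sub1 by (auto simp: fragment_def)
      then have "vars \<psi> \<subseteq> E \<union> V1 \<union> {..N}"
        using vars_subset_binders_le by blast
      then show ?thesis
        using y F(2) by blast
    qed
    then have con2: "consistent \<Gamma>1 \<Delta>2"
      unfolding \<Delta>2_def using consistent_Forall_right con1 x by blast
    have "fragment N S (E \<union> V1) \<subseteq> fragment N S (E \<union> insert y V1)"
      by (rule fragment_mono) auto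
    then have sub2: "\<Gamma>1 \<union> \<Delta>2 \<subseteq> fragment N S (E \<union> insert y V1)"
      using sub1 subst_in_fragment[of x \<phi> N S "E \<union> insert y V1" y] \<chi>1 x(1)
      by (auto simp: \<Delta>2_def)
    have "\<Delta>1 \<subseteq> \<Delta>2"
      by (auto simp: \<Delta>2_def)
    then have "decides F \<chi> \<Gamma>1 \<Delta>2"
      using max_left[of \<Delta>2] ext1 x y unfolding decides_def by (auto simp: \<Delta>2_def)
    moreover have "finite (insert y V1)" "insert y V1 \<subseteq> F" "\<Delta> \<subseteq> \<Delta>2"
      using V1 y ext1 \<open>\<Delta>1 \<subseteq> \<Delta>2\<close> by auto
    ultimately show ?thesis
      using con2 sub2 ext1(1) by blast
  qed
qed

text \<open>Take the even-indexed members of an injective sequence in \<open>A\<close>; the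
  odd-indexed ones remain outside.\<close>

lemma infinite_coinfinite_subset:
  fixes A :: "'a set"
  assumes "infinite A"
  obtains B where "B \<subseteq> A" "infinite B" "infinite (A - B)"
proof -
  obtain f :: "nat \<Rightarrow> 'a" where f: "inj f" "range f \<subseteq> A"
    using assms infinite_countable_subset by blast
  let ?B = "range (\<lambda>n. f (2 * n))" and ?C = "range (\<lambda>n. f (Suc (2 * n)))"
  have "infinite ?B" "infinite ?C"
    using f(1) by (auto intro!: range_inj_infinite injI dest: injD)
  moreover have "?C \<subseteq> A - ?B"
  proof -
    have "f (Suc (2 * m)) \<noteq> f (2 * n)" for m n
      using f(1) by (metis injD double_not_eq_Suc_double)
    then show ?thesis
      using f(2) by auto
  qed
  ultimately show thesis
    using f(2) by (intro that[of ?B]) (auto dest: infinite_super)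
qed

lemma finite_subset_UN_chain:
  fixes X :: "nat \<Rightarrow> 'a set"
  assumes "finite A" "A \<subseteq> (\<Union>n. X n)" "mono X"
  shows "\<exists>n. \<forall>m\<ge>n. A \<subseteq> X m"
  using assms(1,2)
proof (induction A)
  case (insert a A)
  then obtain n k where "\<forall>m\<ge>n. A \<subseteq> X m" "a \<in> X k"
    by auto
  then show ?case
    using monoD[OF assms(3), of k] by (intro exI[of _ "max n k"]) auto
qed simp

lemma lindenbaum:
  assumes con: "consistent \<Gamma> \<Delta>" and sub: "\<Gamma> \<union> \<Delta> \<subseteq> fragment N S E"
    and E: "infinite (- E)" and S: "countable S"
  shows "\<exists>w. maximal N S w \<and> \<Gamma> \<subseteq> ant w \<and> \<Delta> \<subseteq> suc w \<and> E \<subseteq> dom w"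
proof -
  have "infinite (- E - {..N})"
    using E by simp
  \<comment> \<open>\<open>F\<close> supplies the witnesses; the infinite rest stays outside the new
    domain so that the construction can be repeated at successors.\<close>
  then obtain F where F: "F \<subseteq> - E - {..N}" "infinite F" "infinite (- E - {..N} - F)"
    by (rule infinite_coinfinite_subset)
  define D where "D = E \<union> F"
  have F2: "F \<inter> (E \<union> {..N}) = {}"
    using F(1) by auto
  \<comment> \<open>The enumeration covers the final domain from the start. Reserve variables of a
    formula count as used once its stage is reached.\<close>
  define \<chi> where "\<chi> = from_nat_into (fragment N S D)"
  have rng: "range \<chi> = fragment N S D"
    unfolding \<chi>_def
    by (rule range_from_nat_into) (use countable_fragment[OF S] fragment_simps(1) in blast)+
  define Inv where "Inv = (\<lambda>(\<Gamma>', \<Delta>', V). consistent \<Gamma>' \<Delta>' \<and> \<Gamma>' \<union> \<Delta>' \<subseteq> fragment N S (E \<union> V) \<and>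
    finite V \<and> V \<subseteq> F \<and> \<Gamma> \<subseteq> \<Gamma>' \<and> \<Delta> \<subseteq> \<Delta>')"
  define Step where "Step = (\<lambda>n (\<Gamma>1, \<Delta>1, V1 :: var set) (\<Gamma>', \<Delta>', V' :: var set). \<Gamma>1 \<subseteq> \<Gamma>' \<and> \<Delta>1 \<subseteq> \<Delta>' \<and>
    decides F (\<chi> n) \<Gamma>' \<Delta>')"
  have "\<exists>f. \<forall>n. Inv (f n) \<and> Step n (f n) (f (Suc n))"
  proof (rule dependent_nat_choice)
    show "\<exists>p. Inv p"
      using con sub by (intro exI[of _ "(\<Gamma>, \<Delta>, {})"]) (simp add: Inv_def)
  next
    fix p n
    assume p: "Inv p"
    obtain \<Gamma>1 \<Delta>1 V1 where p_eq: "p = (\<Gamma>1, \<Delta>1, V1)"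
      by (cases p) auto
    have "\<chi> n \<in> fragment N S (E \<union> F)"
      using rng by (auto simp: D_def)
    with p have "\<exists>\<Gamma>' \<Delta>' V'. consistent \<Gamma>' \<Delta>' \<and> \<Gamma>' \<union> \<Delta>' \<subseteq> fragment N S (E \<union> V') \<and> finite V' \<and> V' \<subseteq> F \<and>
        \<Gamma>1 \<subseteq> \<Gamma>' \<and> \<Delta>1 \<subseteq> \<Delta>' \<and> decides F (\<chi> n) \<Gamma>' \<Delta>'"
      by (intro lindenbaum_step[of _ _ _ _ _ V1]) (auto simp: Inv_def p_eq F(2) F2)
    then show "\<exists>q. Inv q \<and> Step n p q"
    proof (elim exE conjE, goal_cases)
      case (1 \<Gamma>' \<Delta>' V')
      then have "Inv (\<Gamma>', \<Delta>', V')" "Step n p (\<Gamma>', \<Delta>', V')"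
        using p by (auto simp: Inv_def Step_def p_eq)
      then show ?case
        by blast
    qed
  qed
  then obtain f where f: "\<And>n. Inv (f n)" "\<And>n. Step n (f n) (f (Suc n))"
    by auto
  define G where "G n = fst (f n)" for n
  define H where "H n = fst (snd (f n))" for n
  have inv: "consistent (G n) (H n)" "G n \<union> H n \<subseteq> fragment N S D" "\<Gamma> \<subseteq> G n" "\<Delta> \<subseteq> H n" for n
  proof -
    obtain A B V where fn: "f n = (A, B, V)"
      by (cases "f n") auto
    have *: "V \<subseteq> F" "G n \<union> H n \<subseteq> fragment N S (E \<union> V)"
      and "consistent (G n) (H n)" "\<Gamma> \<subseteq> G n" "\<Delta> \<subseteq> H n"
      using f(1)[of n] by (auto simp: Inv_def fn G_def H_def)
    then show "consistent (G n) (H n)" "\<Gamma> \<subseteq> G n" "\<Delta> \<subseteq> H n"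
      by auto
    show "G n \<union> H n \<subseteq> fragment N S D"
      using * fragment_mono[of "E \<union> V" D N S] by (auto simp: D_def)
  qed
  have step: "G n \<subseteq> G (Suc n)" "H n \<subseteq> H (Suc n)"
    "consistent (insert (\<chi> n) (G (Suc n))) (H (Suc n)) \<Longrightarrow> \<chi> n \<in> G (Suc n)"
    "consistent (G (Suc n)) (insert (\<chi> n) (H (Suc n))) \<Longrightarrow> \<chi> n \<in> H (Suc n)"
    "\<chi> n = Forall x \<phi> \<Longrightarrow> \<chi> n \<in> H (Suc n) \<Longrightarrow> \<exists>y\<in>F. subst \<phi> y x \<in> H (Suc n)" for n x \<phi>
    using f(2)[of n] by (auto simp: Step_def decides_def G_def H_def split: prod.splits)
  have monoG: "mono G" and monoH: "mono H"
    using step(1,2) by (auto simp: mono_iff_le_Suc)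
  define w where "w = World (\<Union>n. G n) (\<Union>n. H n) D"
  \<comment> \<open>A finite subsequent of the limit already lies in a single stage.\<close>
  have con_w: "consistent (ant w) (suc w)"
    unfolding consistent_def
  proof (intro allI impI)
    fix X Y
    assume XY: "fset X \<subseteq> ant w" "fset Y \<subseteq> suc w"
    then obtain m n where "\<forall>k\<ge>m. fset X \<subseteq> G k" "\<forall>k\<ge>n. fset Y \<subseteq> H k"
      using finite_subset_UN_chain[OF finite_fset _ monoG, of X]
        finite_subset_UN_chain[OF finite_fset _ monoH, of Y] by (auto simp: w_def)
    then have "fset X \<subseteq> G (max m n)" "fset Y \<subseteq> H (max m n)"
      by auto
    then show "\<not> X \<turnstile> Y"
      using inv(1) unfolding consistent_def by blast
  qed
  have up: "G n \<subseteq> ant w" "H n \<subseteq> suc w" for n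
    by (auto simp: w_def)
  have idx: "\<exists>n. \<psi> = \<chi> n" if "\<psi> \<in> fragment N S (dom w)" for \<psi>
    using that rng by (auto simp: w_def)
  have "maximal N S w"
    unfolding maximal_def
  proof (intro conjI ballI allI impI)
    show sub_w: "ant w \<union> suc w \<subseteq> fragment N S (dom w)"
      using inv(2) by (fastforce simp: w_def)
    show "dom w \<noteq> {}"
      using F(2) by (auto simp: w_def D_def)
    have "- E - {..N} - F \<subseteq> - D"
      by (auto simp: D_def)
    then show "infinite (- dom w)"
      using F(3) infinite_super by (auto simp: w_def)
    show "\<psi> \<in> ant w" if f: "\<psi> \<in> fragment N S (dom w)" and c: "consistent (insert \<psi> (ant w)) (suc w)" for \<psi>
    proof -
      obtain n where n: "\<psi> = \<chi> n"
        using idx f by blast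
      show ?thesis
        using step(3)[of n] consistent_mono[OF c, of "insert \<psi> (G (Suc n))" "H (Suc n)"] up n by blast
    qed
    show "\<psi> \<in> suc w" if f: "\<psi> \<in> fragment N S (dom w)" and c: "consistent (ant w) (insert \<psi> (suc w))" for \<psi>
    proof -
      obtain n where n: "\<psi> = \<chi> n"
        using idx f by blast
      show ?thesis
        using step(4)[of n] consistent_mono[OF c, of "G (Suc n)" "insert \<psi> (H (Suc n))"] up n by blast
    qed
    show "\<exists>y\<in>dom w. subst \<phi> y x \<in> suc w" if f: "Forall x \<phi> \<in> suc w" for x \<phi>
    proof -
      obtain n where n: "Forall x \<phi> = \<chi> n"
        using idx f sub_w by blast
      \<comment> \<open>Consistency of the limit forces the universal formula into the succedent at
        its own stage, where a witness is supplied, even if it could have entered at another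
        stage.\<close>
      have "consistent (G (Suc n)) (insert (\<chi> n) (H (Suc n)))"
        by (rule consistent_mono[OF con_w]) (use up that n in auto)
      then have "\<exists>y\<in>F. subst \<phi> y x \<in> H (Suc n)"
        using step(4,5) n by metis
      then show ?thesis
        using up by (auto simp: w_def D_def)
    qed
  qed (rule con_w)
  moreover have "\<Gamma> \<subseteq> ant w" "\<Delta> \<subseteq> suc w" "E \<subseteq> dom w"
    using inv(3,4) up by (blast, blast, simp add: w_def D_def)
  ultimately show ?thesis
    by blast
qed

section \<open>Maximal pairs are downward saturated\<close>

context
  fixes N :: nat and S :: "'p set" and w :: "'p world"
  assumes w: "maximal N S w"
begin

lemma maximal_consistent: "consistent (ant w) (suc w)"
  and maximal_ant_fragment: "\<chi> \<in> ant w \<Longrightarrow> \<chi> \<in> fragment N S (dom w)"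
  and maximal_suc_fragment: "\<chi> \<in> suc w \<Longrightarrow> \<chi> \<in> fragment N S (dom w)"
  and maximal_dom: "dom w \<noteq> {}" "infinite (- dom w)"
  and maximal_ant: "\<chi> \<in> fragment N S (dom w) \<Longrightarrow> consistent (insert \<chi> (ant w)) (suc w) \<Longrightarrow> \<chi> \<in> ant w"
  and maximal_suc: "\<chi> \<in> fragment N S (dom w) \<Longrightarrow> consistent (ant w) (insert \<chi> (suc w)) \<Longrightarrow> \<chi> \<in> suc w"
  and maximal_Forall_right: "Forall x \<phi> \<in> suc w \<Longrightarrow> \<exists>y\<in>dom w. subst \<phi> y x \<in> suc w"
  using w unfolding maximal_def by blast+

text \<open>The pattern of this section: a component may be added consistently, it belongs to the
  same fragment, and so maximality says that it is already present.\<close>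

lemma maximal_And_left: "And \<phi> \<psi> \<in> ant w \<Longrightarrow> \<phi> \<in> ant w \<and> \<psi> \<in> ant w"
  using maximal_ant consistent_And_left[OF maximal_consistent] maximal_ant_fragment
  by (metis fragment_simps(2))

lemma maximal_And_right: "And \<phi> \<psi> \<in> suc w \<Longrightarrow> \<phi> \<in> suc w \<or> \<psi> \<in> suc w"
  using maximal_suc consistent_And_right[OF maximal_consistent] maximal_suc_fragment
  by (metis fragment_simps(2))

lemma maximal_Imp_left: "Imp \<phi> \<psi> \<in> ant w \<Longrightarrow> \<phi> \<in> suc w \<or> \<psi> \<in> ant w"
  using maximal_ant maximal_suc consistent_Imp_left[OF maximal_consistent] maximal_ant_fragment
  by (metis fragment_simps(3))

lemma maximal_Imp_right:
  assumes "Imp \<phi> \<psi> \<in> suc w"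
  shows "\<phi> \<in> ant w \<and> \<psi> \<in> suc w"
proof -
  have "consistent (insert \<phi> (ant w)) (insert \<psi> (suc w))"
    using consistent_Imp_right[OF maximal_consistent] assms .
  then have "consistent (insert \<phi> (ant w)) (suc w)" "consistent (ant w) (insert \<psi> (suc w))"
    by (auto elim: consistent_mono)
  then show ?thesis
    using maximal_ant maximal_suc maximal_suc_fragment[OF assms] by simp
qed

lemma maximal_Neg_left: "Neg \<phi> \<in> ant w \<Longrightarrow> \<phi> \<in> suc w"
  using maximal_suc consistent_Neg_left[OF maximal_consistent] maximal_ant_fragment
  by (metis fragment_simps(4))

lemma maximal_Neg_right: "Neg \<phi> \<in> suc w \<Longrightarrow> \<phi> \<in> ant w"
  using maximal_ant consistent_Neg_right[OF maximal_consistent] maximal_suc_fragment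
  by (metis fragment_simps(4))

lemma maximal_Forall_left: "Forall x \<phi> \<in> ant w \<Longrightarrow> z \<in> dom w \<Longrightarrow> subst \<phi> z x \<in> ant w"
  using maximal_ant consistent_Forall_left[OF maximal_consistent] maximal_ant_fragment
    subst_in_fragment by metis

lemma maximal_Pred: "Pred P xs \<in> ant w \<Longrightarrow> Pred P xs \<notin> suc w"
  using inconsistentI[OF Ax[of P xs], of "ant w" "suc w"] maximal_consistent by auto

lemma maximal_Top: "Top \<notin> suc w"
  using inconsistentI[OF TopR, of "ant w" "suc w"] maximal_consistent by auto

lemma maximal_Bot: "Bot \<notin> ant w"
  using inconsistentI[OF BotL, of "ant w" "suc w"] maximal_consistent by auto

text \<open>Besides the unboxed formulas the successor keeps the boxes themselves, which makes the
  inclusion pass along chains of successors.\<close>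

lemma maximal_Box_right:
  assumes "Box \<psi> \<in> suc w" "countable S"
  shows "\<exists>v. maximal N S v \<and> unbox (ant w) \<union> Box ` unbox (ant w) \<subseteq> ant v \<and> \<psi> \<in> suc v \<and> dom w \<subseteq> dom v"
proof -
  have "unbox (ant w) \<union> Box ` unbox (ant w) \<union> {\<psi>} \<subseteq> fragment N S (dom w)"
    using maximal_ant_fragment maximal_suc_fragment[OF assms(1)]
    by (auto simp: unbox_def dest: maximal_ant_fragment)
  then have "\<exists>v. maximal N S v \<and> unbox (ant w) \<union> Box ` unbox (ant w) \<subseteq> ant v \<and> {\<psi>} \<subseteq> suc v \<and>
      dom w \<subseteq> dom v"
    by (intro lindenbaum consistent_Box_right[OF maximal_consistent assms(1)] maximal_dom(2) assms(2))
  then show ?thesis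
    by auto
qed

end

section \<open>The countermodel\<close>

text \<open>Unfolding \<open>Dia\<close>, the formula becomes a box in \<open>ant w\<close>, then a
  negation in \<open>ant v\<close>, then the lower power in \<open>suc v\<close>. Exponent
  \<open>0\<close> is excluded since \<open>Top\<close> is in no succedent.\<close>

lemma Dia_pow_descent:
  assumes "maximal N S w" "maximal N S v" "(Dia ^^ m) Top \<in> suc w"
    and "unbox (ant w) \<subseteq> ant v"
  shows "\<exists>k<m. (Dia ^^ k) Top \<in> suc v"
proof (cases m)
  case 0
  then show ?thesis
    using assms maximal_Top by auto
next
  case (Suc k)
  then have "Neg ((Dia ^^ k) Top) \<in> unbox (ant w)"
    using assms(3) maximal_Neg_right[OF assms(1)] by (simp add: Dia_def unbox_def)
  then have "(Dia ^^ k) Top \<in> suc v"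
    using assms(4) maximal_Neg_left[OF assms(2)] by auto
  then show ?thesis
    using Suc by auto
qed

text \<open>Two implications replace an equivalence, since a formula may lie on neither side.
  \<open>h\<close> and \<open>k\<close> copy worlds and variables into the given types;
  \<open>k\<close> is also the assignment, so each variable denotes its own copy.\<close>

lemma truth_lemma:
  fixes W :: "'p world set" and r :: "('p world \<times> 'p world) set"
    and h :: "'p world \<Rightarrow> 'w" and k :: "var \<Rightarrow> 'd"
  assumes W: "\<And>w. w \<in> W \<Longrightarrow> maximal N S w" and r: "r \<subseteq> W \<times> W"
    and r_Box: "\<And>w v. (w, v) \<in> r \<Longrightarrow> unbox (ant w) \<subseteq> ant v"
    and r_ex: "\<And>w \<psi>. w \<in> W \<Longrightarrow> Box \<psi> \<in> suc w \<Longrightarrow> \<exists>v. (w, v) \<in> r \<and> \<psi> \<in> suc v"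
    and h: "inj_on h W" and k: "inj k"
    and R_def: "R = {(h w, h v) | w v. (w, v) \<in> r}"
    and D_def: "D = (\<lambda>a. k ` dom (inv_into W h a))"
    and I_def: "I = (\<lambda>a P. {map k xs | xs. Pred P xs \<in> ant (inv_into W h a)})"
  shows "w \<in> W \<Longrightarrow> (\<phi> \<in> ant w \<longrightarrow> sat R D I (h w) k \<phi>) \<and> (\<phi> \<in> suc w \<longrightarrow> \<not> sat R D I (h w) k \<phi>)"
proof (induction "depth \<phi>" arbitrary: \<phi> w rule: less_induct)
  case less
  note w = W[OF less.prems]
  have inv_h: "inv_into W h (h w) = w"
    using h less.prems by simp
  show ?case
  proof (cases \<phi>)
    case Top
    then show ?thesis using maximal_Top[OF w] by simp
  next
    case Bot
    then show ?thesis using maximal_Bot[OF w] by simp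
  next
    case (Pred P xs)
    have "map k xs \<in> I (h w) P \<longleftrightarrow> Pred P xs \<in> ant w"
      using inj_mapI[OF k] by (auto simp: I_def inv_h dest: injD)
    then show ?thesis using Pred maximal_Pred[OF w] by auto
  next
    case (And \<alpha> \<beta>)
    then show ?thesis
      using less.hyps[of \<alpha> w] less.hyps[of \<beta> w] less.prems
        maximal_And_left[OF w, of \<alpha> \<beta>] maximal_And_right[OF w, of \<alpha> \<beta>] by auto
  next
    case (Neg \<alpha>)
    then show ?thesis
      using less.hyps[of \<alpha> w] less.prems maximal_Neg_left[OF w, of \<alpha>] maximal_Neg_right[OF w, of \<alpha>]
      by auto
  next
    case (Imp \<alpha> \<beta>)
    then show ?thesis
      using less.hyps[of \<alpha> w] less.hyps[of \<beta> w] less.prems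
        maximal_Imp_left[OF w, of \<alpha> \<beta>] maximal_Imp_right[OF w, of \<alpha> \<beta>] by auto
  next
    case (Forall x \<alpha>)
    \<comment> \<open>Every element of the domain is \<open>k y\<close> for some \<open>y\<close> in
      \<open>dom w\<close>, so instances by variables account for the whole range of the
      quantifier.\<close>
    have IH: "(subst \<alpha> y x \<in> ant w \<longrightarrow> sat R D I (h w) (k(x := k y)) \<alpha>) \<and>
        (subst \<alpha> y x \<in> suc w \<longrightarrow> \<not> sat R D I (h w) (k(x := k y)) \<alpha>)" for y
      using less.hyps[of "subst \<alpha> y x" w] less.prems by (simp add: Forall sat_subst)
    have "D (h w) = k ` dom w"
      by (simp add: D_def inv_h)
    then show ?thesis
      using IH maximal_Forall_left[OF w, of x \<alpha>] maximal_Forall_right[OF w, of x \<alpha>]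
      unfolding Forall by auto
  next
    case (Box \<alpha>)
    have IH: "(\<alpha> \<in> ant v \<longrightarrow> sat R D I (h v) k \<alpha>) \<and> (\<alpha> \<in> suc v \<longrightarrow> \<not> sat R D I (h v) k \<alpha>)"
      if "(w, v) \<in> r" for v
      using less.hyps[of \<alpha> v] that r Box by auto
    have R_iff: "(h w, a) \<in> R \<longleftrightarrow> (\<exists>v. a = h v \<and> (w, v) \<in> r)" for a
      using h less.prems r by (auto simp: R_def dest: inj_onD)
    have "sat R D I (h w) k (Box \<alpha>)" if "Box \<alpha> \<in> ant w"
      using that r_Box IH by (auto simp: R_iff unbox_def)
    moreover have "\<not> sat R D I (h w) k (Box \<alpha>)" if "Box \<alpha> \<in> suc w"
      using r_ex[OF less.prems that] IH R_iff by auto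
    ultimately show ?thesis
      unfolding Box by blast
  qed
qed

text \<open>The countermodel has countably many worlds and variables as individuals; injections into
  the two infinite types turn it into a model that \<open>BL_valid\<close> ranges over.\<close>

lemma completeness:
  fixes \<phi> :: "'p fm"
  assumes infW: "infinite (UNIV :: 'w set)" and infD: "infinite (UNIV :: 'd set)"
    and valid: "BL_valid TYPE('w) TYPE('d) \<phi>"
  shows "{||} \<turnstile> {|\<phi>|}"
proof (rule ccontr)
  assume "\<not> {||} \<turnstile> {|\<phi>|}"
  then obtain n where n: "\<not> {||} \<turnstile> {|(Dia ^^ n) Top, \<phi>|}"
    using BoundL by blast
  obtain N where N: "binders_le N \<phi>"
    using ex_binders_le by blast
  define S where "S = set_fm \<phi>"
  have "finite S"
    unfolding S_def by (induction \<phi>) auto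
  then have S: "countable S"
    by (rule countable_finite)
  have con: "consistent {} {(Dia ^^ n) Top, \<phi>}"
  proof (rule ccontr)
    assume "\<not> ?thesis"
    then obtain G H where *: "G \<turnstile> H" "fset G \<subseteq> {}" "fset H \<subseteq> {(Dia ^^ n) Top, \<phi>}"
      unfolding consistent_def by blast
    have "{||} \<turnstile> {|(Dia ^^ n) Top, \<phi>|}"
      by (rule Weak[OF *(1)]) (use *(2,3) in auto)
    then show False
      using n by simp
  qed
  have "\<exists>w. maximal N S w \<and> {} \<subseteq> ant w \<and> {(Dia ^^ n) Top, \<phi>} \<subseteq> suc w \<and> fv \<phi> \<subseteq> dom w"
  proof (rule lindenbaum[OF con _ _ S])
    show "{} \<union> {(Dia ^^ n) Top, \<phi>} \<subseteq> fragment N S (fv \<phi>)"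
      using N by (auto simp: fragment_def S_def binders_le_Dia_pow fv_Dia_pow set_fm_Dia_pow)
    show "infinite (- fv \<phi>)"
      by (simp add: finite_compl)
  qed
  then obtain w0 where w0: "maximal N S w0" "(Dia ^^ n) Top \<in> suc w0" "\<phi> \<in> suc w0" "fv \<phi> \<subseteq> dom w0"
    by auto

  \<comment> \<open>One fixed successor is chosen per boxed succedent formula, so only countably
    many worlds are reachable from \<open>w0\<close>.\<close>
  define s where "s w \<psi> = (SOME v. maximal N S v \<and> unbox (ant w) \<union> Box ` unbox (ant w) \<subseteq> ant v \<and>
    \<psi> \<in> suc v \<and> dom w \<subseteq> dom v)" for w \<psi>
  have s: "maximal N S (s w \<psi>) \<and> unbox (ant w) \<union> Box ` unbox (ant w) \<subseteq> ant (s w \<psi>) \<and>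
      \<psi> \<in> suc (s w \<psi>) \<and> dom w \<subseteq> dom (s w \<psi>)"
    if "maximal N S w" "Box \<psi> \<in> suc w" for w \<psi>
    unfolding s_def by (rule someI_ex) (rule maximal_Box_right[OF that S])
  define step where "step = {(w, s w \<psi>) | w \<psi>. maximal N S w \<and> Box \<psi> \<in> suc w}"
  define W where "W = step\<^sup>* `` {w0}"
  define r where "r = step\<^sup>+ \<inter> W \<times> W"

  have w0W: "w0 \<in> W"
    by (auto simp: W_def)
  have maxW: "maximal N S w" if "w \<in> W" for w
  proof -
    have "(w0, w) \<in> step\<^sup>*"
      using that by (simp add: W_def)
    then show ?thesis
      by (induction rule: rtrancl_induct) (use w0(1) s in \<open>auto simp: step_def\<close>)
  qed
  have "countable W"
    unfolding W_def
  proof (rule countable_rtrancl)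
    fix Y :: "'p world set" assume Y: "countable Y"
    have "countable {\<psi>. Box \<psi> \<in> suc w}" if "maximal N S w" for w
    proof -
      have "{\<psi>. Box \<psi> \<in> suc w} \<subseteq> fragment N S (dom w)"
        using maximal_suc_fragment[OF that] by fastforce
      then show ?thesis
        using countable_fragment[OF S] countable_subset by blast
    qed
    then have "countable (\<Union>w\<in>Y \<inter> {w. maximal N S w}. s w ` {\<psi>. Box \<psi> \<in> suc w})"
      using Y by (intro countable_UN countable_Int1) auto
    moreover have "step `` Y \<subseteq> (\<Union>w\<in>Y \<inter> {w. maximal N S w}. s w ` {\<psi>. Box \<psi> \<in> suc w})"
      by (auto simp: step_def)
    ultimately show "countable (step `` Y)"
      by (rule countable_subset[rotated])
  qed simp
  obtain g :: "nat \<Rightarrow> 'w" where g: "inj g"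
    using infinite_countable_subset[OF infW] by blast
  obtain k :: "nat \<Rightarrow> 'd" where k: "inj k"
    using infinite_countable_subset[OF infD] by blast
  define h where "h = g \<circ> to_nat_on W"
  have h: "inj_on h W"
    unfolding h_def using inj_on_to_nat_on[OF \<open>countable W\<close>] g
    by (intro comp_inj_on) (auto intro: inj_on_subset)
  define R where "R = {(h w, h v) | w v. (w, v) \<in> r}"
  define D where "D = (\<lambda>a. k ` dom (inv_into W h a))"
  define I where "I = (\<lambda>a P. {map k xs | xs. Pred P xs \<in> ant (inv_into W h a)})"
  have inv_h: "inv_into W h (h w) = w" if "w \<in> W" for w
    using h that by simp
  have rW: "r \<subseteq> W \<times> W"
    by (auto simp: r_def)

  \<comment> \<open>Along a chain of steps the boxes in the antecedents are preserved, so
    \<open>unbox (ant w)\<close> only grows; this is where the boxes kept in successors are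
    used.\<close>
  have tr: "unbox (ant w) \<union> Box ` unbox (ant w) \<subseteq> ant v \<and> dom w \<subseteq> dom v" if "(w, v) \<in> r" for w v
  proof -
    have "(w, v) \<in> step\<^sup>+"
      using that by (simp add: r_def)
    then show ?thesis
    proof (induction rule: trancl_induct)
      case (base y)
      then show ?case
        using s by (force simp: step_def)
    next
      case (step y z)
      then have "unbox (ant y) \<subseteq> ant z" "Box ` unbox (ant y) \<subseteq> ant z" "dom y \<subseteq> dom z"
        using s by (force simp: step_def)+
      moreover have "unbox (ant w) \<subseteq> unbox (ant y)"
        using step.IH by (auto simp: unbox_def)
      ultimately show ?case
        using step.IH by blast
    qed
  qed
  have r_ex: "\<exists>v. (w, v) \<in> r \<and> \<psi> \<in> suc v" if "w \<in> W" "Box \<psi> \<in> suc w" for w \<psi>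
  proof -
    have "(w, s w \<psi>) \<in> step"
      using maxW that by (auto simp: step_def)
    moreover from this have "s w \<psi> \<in> W"
      using that(1) by (auto simp: W_def)
    ultimately show ?thesis
      using that s[OF maxW] by (auto simp: r_def)
  qed
  have truth: "(\<psi> \<in> ant w \<longrightarrow> sat R D I (h w) k \<psi>) \<and> (\<psi> \<in> suc w \<longrightarrow> \<not> sat R D I (h w) k \<psi>)"
    if "w \<in> W" for w \<psi>
    by (rule truth_lemma[OF maxW rW _ r_ex h k R_def D_def I_def that]) (use tr in auto)

  \<comment> \<open>Every world other than \<open>w0\<close> is a direct \<open>r\<close>-successor
    of \<open>w0\<close>, as \<open>r\<close> comes from the transitive closure, so a single descent
    suffices.\<close>
  have "\<exists>m. (Dia ^^ m) Top \<in> suc w" if "w \<in> W" for w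
  proof (cases "w = w0")
    case True
    then show ?thesis
      using w0(2) by auto
  next
    case False
    then have "(w0, w) \<in> r"
      using that w0W by (auto simp: r_def W_def rtrancl_eq_or_trancl)
    then show ?thesis
      using Dia_pow_descent[OF w0(1) maxW[OF that] w0(2)] tr by blast
  qed
  then obtain rank where rank: "\<And>w. w \<in> W \<Longrightarrow> (Dia ^^ rank w) Top \<in> suc w"
    by metis
  \<comment> \<open>The values of \<open>rank\<close> are arbitrary choices and need not decrease
    along \<open>r\<close>. The path is therefore followed by a separate exponent \<open>m\<close>
    that starts at \<open>rank w\<close> and drops at each edge; \<open>i = j\<close> then bounds
    the length.\<close>
  have path: "\<exists>m. (Dia ^^ m) Top \<in> suc (inv_into W h (p i)) \<and> p i \<in> h ` W \<and> m + i \<le> rank w"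
    if "w \<in> W" "p 0 = h w" "\<forall>i<j. (p i, p (Suc i)) \<in> R" "i \<le> j" for w p i j
    using that(4)
  proof (induction i)
    case 0
    then show ?case
      using that(1,2) rank by (auto simp: inv_h)
  next
    case (Suc i)
    then obtain m where m: "(Dia ^^ m) Top \<in> suc (inv_into W h (p i))" "m + i \<le> rank w"
      by auto
    have "(p i, p (Suc i)) \<in> R"
      using that(3) Suc.prems by auto
    then obtain u v where uv: "p i = h u" "p (Suc i) = h v" "(u, v) \<in> r" "u \<in> W" "v \<in> W"
      using rW by (auto simp: R_def)
    then obtain l where "l < m" "(Dia ^^ l) Top \<in> suc v"
      using Dia_pow_descent[OF maxW maxW, of u v m] m(1) tr inv_h by auto
    then show ?case
      using uv m(2) inv_h by (intro exI[of _ l]) auto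
  qed
  have "bounded_length (h ` W) R"
    unfolding bounded_length_def
  proof (intro ballI)
    fix a assume "a \<in> h ` W"
    then obtain w where w: "a = h w" "w \<in> W"
      by auto
    show "bdd_above {j::nat. \<exists>p. p 0 = a \<and> (\<forall>i<j. (p i, p (Suc i)) \<in> R)}"
    proof (rule bdd_aboveI[of _ "rank w"])
      fix j assume "j \<in> {j::nat. \<exists>p. p 0 = a \<and> (\<forall>i<j. (p i, p (Suc i)) \<in> R)}"
      then obtain p where "p 0 = h w" "\<forall>i<j. (p i, p (Suc i)) \<in> R"
        using w by auto
      from path[OF w(2) this order_refl] show "j \<le> rank w"
        by auto
    qed
  qed
  moreover have "trans R"
  proof (rule transI)
    fix a b c assume "(a, b) \<in> R" "(b, c) \<in> R"
    then obtain u v v' z where "a = h u" "b = h v" "b = h v'" "c = h z" "(u, v) \<in> r" "(v', z) \<in> r"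
      by (auto simp: R_def)
    moreover from this have "v = v'"
      using h rW by (auto dest: inj_onD)
    moreover have "trans r"
      unfolding r_def by (intro trans_Int trans_trancl) (auto intro: transI)
    ultimately show "(a, c) \<in> R"
      by (auto simp: R_def dest: transD)
  qed
  moreover have frame: "kripke_frame (h ` W) R"
    using w0W rW by (auto simp: kripke_frame_def R_def)
  ultimately have "(h ` W, R) \<in> BL"
    by (simp add: BL_def)
  moreover have "kripke_model (h ` W) R D I"
    unfolding kripke_model_def
  proof (intro conjI frame allI impI ballI)
    show "D a \<noteq> {}" if "a \<in> h ` W" for a
      using that maximal_dom(1)[OF maxW] by (auto simp: D_def inv_h)
    show "D a \<subseteq> D b" if "(a, b) \<in> R" for a b
    proof -
      obtain u v where "a = h u" "b = h v" "(u, v) \<in> r" "u \<in> W" "v \<in> W"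
        using \<open>(a, b) \<in> R\<close> rW by (auto simp: R_def)
      then show ?thesis
        using tr by (simp add: D_def inv_h image_mono)
    qed
    show "I a P \<subseteq> lists (D a)" if a: "a \<in> h ` W" for a P
    proof -
      obtain w where w: "a = h w" "w \<in> W"
        using a by auto
      have "set xs \<subseteq> dom w" if "Pred P xs \<in> ant w" for xs
        using maximal_ant_fragment[OF maxW[OF w(2)] that] by (simp add: fragment_def)
      then show ?thesis
        using w by (fastforce simp: I_def D_def inv_h)
    qed
  qed
  ultimately have univ: "sat R D I (h w0) k (univ_closure \<phi>)"
    using valid w0W unfolding BL_valid_def frame_valid_def by blast
  obtain d where d: "d \<in> dom w0"
    using maximal_dom(1)[OF w0(1)] by auto
  \<comment> \<open>\<open>k\<close> sends variables outside \<open>dom w0\<close> outside the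
    domain of the root. \<open>e\<close> agrees with it on the free variables of \<phi> and takes
    the default \<open>k d\<close> elsewhere, so that the universal closure can be
    instantiated.\<close>
  define e where "e x = (if x \<in> fv \<phi> then k x else k d)" for x
  have Dw0: "D (h w0) = k ` dom w0"
    by (simp add: D_def inv_h w0W)
  have "range e \<subseteq> D (h w0)"
    using w0(4) d by (auto simp: e_def Dw0)
  then have "sat R D I (h w0) e \<phi>"
    using univ d by (subst (asm) sat_univ_closure) (auto simp: Dw0)
  then have "sat R D I (h w0) k \<phi>"
    by (rule sat_cong[THEN iffD1, rotated]) (simp add: e_def)
  then show False
    using truth[OF w0W] w0(3) by blast
qed

theorem theorem9:
  fixes \<phi> :: "'p fm"
  assumes "infinite (UNIV :: 'w set)" and "infinite (UNIV :: 'd set)"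
  shows "({||} \<turnstile> {|\<phi>|}) \<longleftrightarrow> BL_valid TYPE('w) TYPE('d) \<phi>"
proof
  assume der: "{||} \<turnstile> {|\<phi>|}"
  show "BL_valid TYPE('w) TYPE('d) \<phi>"
    unfolding BL_valid_def frame_valid_def
  proof (intro allI impI ballI)
    fix W :: "'w set" and R :: "('w \<times> 'w) set" and D :: "'w \<Rightarrow> 'd set"
      and I :: "'w \<Rightarrow> 'p \<Rightarrow> 'd list set" and w e
    assume BL: "(W, R) \<in> BL" and model: "kripke_model W R D I" and w: "w \<in> W"
    have "D w \<noteq> {}"
      using model w by (simp add: kripke_model_def)
    moreover have "sat R D I w e' \<phi>" if "range e' \<subseteq> D w" for e'
      using soundness[OF der model _ _ w that] BL by (auto simp: BL_def)
    ultimately show "sat R D I w e (univ_closure \<phi>)"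
      by (simp add: sat_univ_closure)
  qed
next
  assume "BL_valid TYPE('w) TYPE('d) \<phi>"
  with assms show "{||} \<turnstile> {|\<phi>|}"
    by (rule completeness)
qed

end
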